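(* Let $\dot H=\ddot H=H$ be the Hilbert cube, let $\dot A\subseteq\dot H$ and $\ddot A\subseteq\ddot H$ be analytic sets, and let $A:\dot A\rightarrow\ddot A$ be a function which is analytic as a subset of $\dot A\times\ddot A$. Then either $A$ can be covered by countably many continuous functions, or else there are maps $\dot\varphi:\omega^\omega\rightarrow\dot A$ and $\ddot\varphi:\omega^\omega\rightarrow\ddot A$ such that $A\circ\dot\varphi=\ddot\varphi\circ P$ and (i) $\dot\varphi$ is a topological embedding from $\omega^\omega$ with the Cantor topology into $\dot A$, (ii) $\ddot\varphi$ is a topological embedding from $\omega^\omega$ with the Baire topology into $\ddot A$.
   Context: Functions are identified with their graphs. "$A$ can be covered by countably many continuous functions" means that there are countably many continuous functions $f_n:D_n\to\ddot H$, with $D_n\subseteq\dot H$ arbitrary subsets (with the subspace topology), such that $A\subseteq\bigcup_n f_n$ as sets of pairs. The sets $\dot A,\ddot A$ carry the subspace topologies. Two topologies on $\omega^\omega$ are considered. The Baire topology is the usual one (product of discrete topologies on $\omega$). The Cantor topology is the product topology obtained when each factor $\omega$ is given the topology induced by identifying it with the subspace $\{0\}\cup\{2^{-n}:1\le n<\omega\}$ of $[0,1]$ via $0\mapsto 0$ and $n\mapsto 2^{-n}$ for $n\ge 1$ (this space is homeomorphic to $2^\omega$). The function $P$ is the identity map from $\omega^\omega$ with the Cantor topology into $\omega^\omega$ with the Baire topology. *)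

theory Defs
  imports "HOL-Analysis.Analysis"
begin

definition hilbert_cube :: "(nat \<Rightarrow> real) topology" where
  "hilbert_cube = product_topology (\<lambda>_. top_of_set {0..1}) UNIV"

definition baire_topology :: "(nat \<Rightarrow> nat) topology" where
  "baire_topology = product_topology (\<lambda>_. discrete_topology UNIV) UNIV"

definition seq_code :: "nat \<Rightarrow> real" where
  "seq_code n = (if n = 0 then 0 else (1 / 2) ^ n)"

text \<open>
  Each factor carries the topology that makes the injection \<^const>\<open>seq_code\<close> a homeomorphism onto
  its range, a convergent sequence together with its limit 0; so the factor is a compact space
  whose only non-isolated point is \<open>0\<close>.
\<close>
definition cantor_topology :: "(nat \<Rightarrow> nat) topology" where
  "cantor_topology = product_topology (\<lambda>_. pullback_topology UNIV seq_code euclideanreal) UNIV"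

text \<open>
  The identity on points; its intended domain is \<^const>\<open>cantor_topology\<close> and its codomain is
  \<^const>\<open>baire_topology\<close>.
\<close>
definition P_map :: "(nat \<Rightarrow> nat) \<Rightarrow> (nat \<Rightarrow> nat)" where
  "P_map = (\<lambda>x. x)"

text \<open>
  Analytic sets as continuous images of the Baire space, together with the empty set. The ambient
  space \<open>X\<close> need not be Polish: for \<open>X\<close> a subspace of a larger space, this is analyticity in
  the larger space of a set contained in \<open>X\<close>.
\<close>
definition analytic_in :: "'a topology \<Rightarrow> 'a set \<Rightarrow> bool" where
  "analytic_in X A \<longleftrightarrow>
     A = {} \<or> (\<exists>f. continuous_map baire_topology X f \<and> f ` topspace baire_topology = A)"

definition fun_graph :: "'a set \<Rightarrow> ('a \<Rightarrow> 'b) \<Rightarrow> ('a \<times> 'b) set" where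
  "fun_graph D f = {(x, f x) | x. x \<in> D}"

text \<open>
  A finite cover is an infinite one padded with the empty function (\<open>D n = {}\<close>), so countable
  families are indexed by \<^typ>\<open>nat\<close>.
\<close>
definition countably_continuous_cover ::
    "'a topology \<Rightarrow> 'b topology \<Rightarrow> ('a \<times> 'b) set \<Rightarrow> bool" where
  "countably_continuous_cover X Y G \<longleftrightarrow>
     (\<exists>(D :: nat \<Rightarrow> 'a set) (f :: nat \<Rightarrow> 'a \<Rightarrow> 'b).
        (\<forall>n. D n \<subseteq> topspace X \<and> continuous_map (subtopology X (D n)) Y (f n)) \<and>
        G \<subseteq> (\<Union>n. fun_graph (D n) (f n)))"

end

theory Submission
  imports Defs
begin

text \<open>
  Parametrize the graph of \<open>A\<close> by a continuous map \<open>z \<mapsto> (p z, q z)\<close> of the Baire space, and call a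
  set of parameters small if countably many continuous restrictions of \<open>A\<close> cover its image. Suppose
  that the whole Baire space is not small. The embedding is built from finite approximations: a
  stage has a finite box of leaves \<open>d \<in> \<omega>\<^sup>\<omega>\<close> (eventually zero), and each leaf carries an open set of
  parameters together with one open reservoir for each of its zero coordinates. Future copies of
  \<open>d\<close> with \<open>d i = 0\<close> replaced by a new value are taken from the reservoir of \<open>d\<close> at \<open>i\<close>. They have to
  be close to \<open>d\<close> under \<open>p\<close> (continuity in the Cantor topology) but far from each other under \<open>q\<close>
  (discreteness in the Baire topology). Closeness is possible because \<open>p\<close> maps the leaf into the
  support of the reservoir, so the reservoir is not small in any neighbourhood. Discreteness is
  achieved by shrinking the reservoir, under \<open>q\<close>, to a neighbourhood of a cluster point that new
  copies avoid; cluster points exist because the Hilbert cube is compact.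
\<close>

subsection \<open>Small sets and supports\<close>

definition cylinder :: "nat \<Rightarrow> (nat \<Rightarrow> 'c) \<Rightarrow> (nat \<Rightarrow> 'c) set" where
  "cylinder n z = {w. \<forall>j<n. w j = z j}"

lemma open_cylinder: "open (cylinder n (z :: nat \<Rightarrow> nat))"
proof -
  have "cylinder n z = Pi\<^sub>E UNIV (\<lambda>j. if j < n then {z j} else UNIV)"
    by (auto simp: cylinder_def PiE_def Pi_def split: if_splits)
  moreover have "open (Pi\<^sub>E UNIV (\<lambda>j. if j < n then {z j} else UNIV))"
    by (rule open_PiE) (auto simp: open_discrete intro: finite_subset[of _ "{..<n}"] split: if_splits)
  ultimately show ?thesis by simp
qed

lemma mem_cylinder_self [simp]: "z \<in> cylinder n z"
  by (simp add: cylinder_def)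

lemma finite_separated:
  assumes "finite (S :: 'b::metric_space set)"
  obtains r where "r > 0" "\<And>x y. x \<in> S \<Longrightarrow> y \<in> S \<Longrightarrow> x \<noteq> y \<Longrightarrow> r \<le> dist x y"
proof -
  have "\<exists>r>0. \<forall>x\<in>S. \<forall>y\<in>S. x \<noteq> y \<longrightarrow> r \<le> dist x y"
    using assms
  proof induction
    case empty
    then show ?case by (auto intro: exI[of _ 1])
  next
    case (insert a S)
    then obtain r where r: "r > 0" "\<forall>x\<in>S. \<forall>y\<in>S. x \<noteq> y \<longrightarrow> r \<le> dist x y" by blast
    obtain d where d: "d > 0" "\<forall>x\<in>S. x \<noteq> a \<longrightarrow> d \<le> dist a x"
      using finite_set_avoid[OF insert.hyps(1), of a] by blast
    then show ?case
      using r by (intro exI[of _ "min r d"]) (auto simp: dist_commute min.coboundedI1 min.coboundedI2)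
  qed
  then show ?thesis using that by blast
qed

text \<open>\<open>q\<close> is kept apart from \<open>A\<close> composed with \<open>p\<close>
  because \<open>q\<close> is continuous while \<open>A\<close> need not be. The compact set
  \<open>K\<close> supplies the cluster points.\<close>

locale parametrized_function =
  fixes p :: "(nat \<Rightarrow> nat) \<Rightarrow> 'a::{metric_space, second_countable_topology}"
    and q :: "(nat \<Rightarrow> nat) \<Rightarrow> 'b::{metric_space, second_countable_topology}"
    and A :: "'a \<Rightarrow> 'b" and K :: "'b set"
  assumes cont_p: "continuous_on UNIV p" and cont_q: "continuous_on UNIV q"
    and q_eq: "q z = A (p z)" and compact_K: "compact K" and q_in_K: "q z \<in> K"
begin

lemma open_p_vimage: "open V \<Longrightarrow> open (p -` V)"
  using cont_p by (simp add: open_vimage)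

lemma open_q_vimage: "open V \<Longrightarrow> open (q -` V)"
  using cont_q by (simp add: open_vimage)

definition small :: "(nat \<Rightarrow> nat) set \<Rightarrow> bool" where
  "small S \<longleftrightarrow> (\<exists>T :: nat \<Rightarrow> _. S \<subseteq> (\<Union>n. T n) \<and> (\<forall>n. continuous_on (p ` T n) A))"

lemma small_subset: "small S \<Longrightarrow> S' \<subseteq> S \<Longrightarrow> small S'"
  unfolding small_def by blast

lemma small_continuous: "continuous_on (p ` S) A \<Longrightarrow> small S"
  unfolding small_def by (rule exI[of _ "\<lambda>_. S"]) auto

lemma small_empty [simp]: "small {}"
  by (rule small_continuous) simp

lemma small_countable_Union:
  assumes "countable I" "\<And>i. i \<in> I \<Longrightarrow> small (S i)"
  shows "small (\<Union>i\<in>I. S i)"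
proof (cases "I = {}")
  case False
  have "\<forall>i\<in>I. \<exists>T :: nat \<Rightarrow> _. S i \<subseteq> (\<Union>n. T n) \<and> (\<forall>n. continuous_on (p ` T n) A)"
    using assms(2) unfolding small_def by blast
  then obtain T :: "_ \<Rightarrow> nat \<Rightarrow> _" where
    T: "\<forall>i\<in>I. S i \<subseteq> (\<Union>n. T i n) \<and> (\<forall>n. continuous_on (p ` T i n) A)"
    by metis
  let ?e = "from_nat_into I"
  have e: "range ?e = I" using range_from_nat_into[OF False assms(1)] .
  let ?T = "\<lambda>n. T (?e (fst (prod_decode n))) (snd (prod_decode n))"
  have "(\<Union>i\<in>I. S i) \<subseteq> (\<Union>n. ?T n)"
  proof
    fix x assume "x \<in> (\<Union>i\<in>I. S i)"
    then obtain i where "i \<in> range ?e" "x \<in> S i" using e by blast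
    then obtain k where "x \<in> S (?e k)" by blast
    then obtain n where "x \<in> T (?e k) n" using T e by blast
    then have "x \<in> ?T (prod_encode (k, n))" by simp
    then show "x \<in> (\<Union>n. ?T n)" by blast
  qed
  moreover have "continuous_on (p ` ?T n) A" for n
    using T e by blast
  ultimately show ?thesis unfolding small_def by blast
qed simp

lemma small_Un: "small S \<Longrightarrow> small S' \<Longrightarrow> small (S \<union> S')"
  using small_countable_Union[of "UNIV :: bool set" "\<lambda>b. if b then S else S'"]
  by (auto simp: UNIV_bool Un_commute)

text \<open>\<open>A\<close> is constant on the image of a fibre of \<open>q\<close> under
  \<open>p\<close>. Hence finitely many \<open>q\<close>-values can be avoided inside any set that
  is not small.\<close>

lemma small_q_fibre: "small {z. q z = y}"
proof (rule small_continuous)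
  have "continuous_on (p ` {z. q z = y}) (\<lambda>_. y)" by simp
  then show "continuous_on (p ` {z. q z = y}) A"
    by (rule continuous_on_eq) (auto simp: q_eq)
qed

lemma small_q_preimage_finite: "finite F \<Longrightarrow> small (q -` F)"
  by (rule small_subset[OF small_countable_Union[of F "\<lambda>y. {z. q z = y}"]])
    (auto simp: countable_finite small_q_fibre)

text \<open>The analogue of the closed support of a measure, with small sets as null sets. It is
  used for \<open>p\<close>, for the pair of \<open>p\<close> and \<open>q\<close>, and for the
  identity of the parameter space.\<close>

definition supp :: "((nat \<Rightarrow> nat) \<Rightarrow> 'c::topological_space) \<Rightarrow> (nat \<Rightarrow> nat) set \<Rightarrow> 'c set" where
  "supp g S = {x. \<forall>V. open V \<and> x \<in> V \<longrightarrow> \<not> small (S \<inter> g -` V)}"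

lemma supp_mono: "S \<subseteq> S' \<Longrightarrow> supp g S \<subseteq> supp g S'"
proof
  fix x assume S: "S \<subseteq> S'" and x: "x \<in> supp g S"
  have "\<not> small (S' \<inter> g -` V)" if "open V" "x \<in> V" for V
  proof
    assume "small (S' \<inter> g -` V)"
    then have "small (S \<inter> g -` V)" by (rule small_subset) (use S in auto)
    then show False using x that unfolding supp_def by blast
  qed
  then show "x \<in> supp g S'" unfolding supp_def by blast
qed

lemma supp_empty [simp]: "supp g {} = {}"
  unfolding supp_def by auto

lemma supp_Un: "supp g (S \<union> S') \<subseteq> supp g S \<union> supp g S'"
proof
  fix x assume x: "x \<in> supp g (S \<union> S')"
  show "x \<in> supp g S \<union> supp g S'"
  proof (rule ccontr)
    assume "\<not> ?thesis"
    then obtain V V' where V: "open V" "x \<in> V" "small (S \<inter> g -` V)"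
        "open V'" "x \<in> V'" "small (S' \<inter> g -` V')"
      unfolding supp_def by blast
    then have "small ((S \<inter> g -` V) \<union> (S' \<inter> g -` V'))" by (simp add: small_Un)
    then have "small ((S \<union> S') \<inter> g -` (V \<inter> V'))" by (rule small_subset) auto
    then show False using x V unfolding supp_def by blast
  qed
qed

lemma closed_supp: "closed (supp g S)"
proof -
  have "open (- supp g S)"
    by (subst open_subopen) (auto simp: supp_def)
  then show ?thesis by (simp add: closed_def)
qed

lemma supp_subset_closed: "closed C \<Longrightarrow> supp g (S \<inter> g -` C) \<subseteq> C"
proof
  fix x assume "closed C" "x \<in> supp g (S \<inter> g -` C)"
  moreover have "(S \<inter> g -` C) \<inter> g -` (- C) = {}" by auto
  ultimately show "x \<in> C"
    unfolding supp_def using small_empty by (metis (mono_tags, lifting) ComplI mem_Collect_eq open_Compl)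
qed

text \<open>Every value outside the support has a basic neighbourhood with small preimage in
  \<open>S\<close>, and a countable base has only countably many of these.\<close>

lemma small_outside_supp:
  fixes g :: "(nat \<Rightarrow> nat) \<Rightarrow> 'c::second_countable_topology"
  shows "small (S - g -` supp g S)"
proof -
  obtain B :: "'c set set" where B: "countable B" "topological_basis B"
    using ex_countable_basis by blast
  let ?I = "{V \<in> B. small (S \<inter> g -` V)}"
  have "small (\<Union>V\<in>?I. S \<inter> g -` V)"
    using B by (intro small_countable_Union) auto
  moreover have "S - g -` supp g S \<subseteq> (\<Union>V\<in>?I. S \<inter> g -` V)"
  proof
    fix z assume z: "z \<in> S - g -` supp g S"
    then obtain V where V: "open V" "g z \<in> V" "small (S \<inter> g -` V)"
      unfolding supp_def by blast
    obtain V' where V': "V' \<in> B" "g z \<in> V'" "V' \<subseteq> V"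
      using topological_basisE[OF B(2) V(1,2)] by blast
    have "small (S \<inter> g -` V')" by (rule small_subset[OF V(3)]) (use V' in auto)
    then show "z \<in> (\<Union>V\<in>?I. S \<inter> g -` V)" using z V' by auto
  qed
  ultimately show ?thesis by (rule small_subset)
qed

lemma supp_nonempty:
  fixes g :: "(nat \<Rightarrow> nat) \<Rightarrow> 'c::second_countable_topology"
  assumes "\<not> small S"
  shows "supp g S \<noteq> {}"
  using small_outside_supp[of S g] assms by auto

lemma not_small_Diff: "\<not> small S \<Longrightarrow> small S' \<Longrightarrow> \<not> small (S - S')"
  using small_Un[of "S - S'" S'] small_subset[of "S - S' \<union> S'" S] by blast

text \<open>
  If all these intersections were small, then removing countably many of them would leave a set on
  which \<open>A\<close> is continuous.
\<close>

lemma split_nonsmall: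
  assumes "\<not> small X"
  obtains c e where "e > 0"
    "\<not> small ({z \<in> X. dist (q z) c < e} \<inter> p -` supp p {z \<in> X. dist (q z) c > 2 * e})"
proof -
  let ?g = "\<lambda>z. (p z, q z)"
  \<comment> \<open>Every neighbourhood of the graph point of a parameter in \<open>Y\<close>
    contains the graph points of a non-small part of \<open>X\<close>; only a small set is
    discarded.\<close>
  define Y where "Y = X \<inter> ?g -` supp ?g X"
  have nY: "\<not> small Y"
    using not_small_Diff[OF assms small_outside_supp[of X ?g]] by (simp add: Y_def Diff_Diff_Int)
  obtain C :: "'b set" where C: "countable C" "\<And>U. open U \<Longrightarrow> U \<noteq> {} \<Longrightarrow> \<exists>d\<in>C. d \<in> U"
    using countable_dense_setE by blast
  define I where "I = C \<times> (range (\<lambda>n. 1 / real (Suc n)))"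
  define Z where "Z = (\<lambda>(c, e). {z \<in> X. dist (q z) c < e} \<inter> p -` supp p {z \<in> X. dist (q z) c > 2 * e})"
  have "\<exists>i\<in>I. \<not> small (Z i)"
  proof (rule ccontr)
    assume "\<not> ?thesis"
    then have sm: "small (\<Union>i\<in>I. Z i)"
      by (intro small_countable_Union) (auto simp: I_def C(1))
    define Y' where "Y' = Y - (\<Union>i\<in>I. Z i)"
    have "\<not> small Y'" unfolding Y'_def using nY sm by (rule not_small_Diff)
    moreover have "small Y'"
    proof (rule small_continuous, unfold continuous_on_iff, intro ballI allI impI)
      fix x and e :: real assume "x \<in> p ` Y'" "e > 0"
      then obtain z where z: "z \<in> Y'" "x = p z" by blast
      obtain n where n: "1 / real (Suc n) < e / 3"
        using \<open>e > 0\<close> nat_approx_posE[of "e/3"] by (metis divide_pos_pos zero_less_numeral)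
      let ?e = "1 / real (Suc n)"
      obtain c where c: "c \<in> C" "dist (q z) c < ?e"
        using C(2)[of "ball (q z) ?e"] by auto
      have "z \<notin> Z (c, ?e)" using z c unfolding Y'_def I_def by blast
      then have "p z \<notin> supp p {z \<in> X. dist (q z) c > 2 * ?e}"
        using z c unfolding Z_def Y'_def Y_def by auto
      then obtain V where V: "open V" "p z \<in> V" "small ({z \<in> X. dist (q z) c > 2 * ?e} \<inter> p -` V)"
        unfolding supp_def by blast
      obtain d where d: "d > 0" "ball (p z) d \<subseteq> V" using V by (meson open_contains_ball)
      show "\<exists>d>0. \<forall>x'\<in>p ` Y'. dist x' x < d \<longrightarrow> dist (A x') (A x) < e"
      proof (intro exI conjI ballI impI)
        fix x' assume "x' \<in> p ` Y'" "dist x' x < d"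
        then obtain z' where z': "z' \<in> Y'" "x' = p z'" "p z' \<in> V"
          using d z by (auto simp: dist_commute subset_iff)
        \<comment> \<open>Otherwise the box \<open>?U\<close> is a neighbourhood of a point of the
          graph support, although its preimage in \<open>X\<close> is small by the choice of
          \<open>V\<close>.\<close>
        have "\<not> dist (q z') c > 2 * ?e"
        proof
          assume far: "dist (q z') c > 2 * ?e"
          let ?U = "V \<times> {y. dist y c > 2 * ?e}"
          have "open ?U"
            by (intro open_Times V open_Collect_less continuous_intros)
          moreover have "?g z' \<in> ?U" using far z' by simp
          moreover have "?g z' \<in> supp ?g X" using z' unfolding Y'_def Y_def by simp
          ultimately have "\<not> small (X \<inter> ?g -` ?U)" unfolding supp_def by blast
          moreover have "small (X \<inter> ?g -` ?U)"
            by (rule small_subset[OF V(3)]) auto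
          ultimately show False by blast
        qed
        then have "dist (q z') (q z) \<le> 3 * ?e"
          using c(2) dist_triangle2[of "q z'" "q z" c] by linarith
        then show "dist (A x') (A x) < e" using n by (simp add: z z' q_eq)
      qed (rule d)
    qed
    ultimately show False by blast
  qed
  then obtain i where i: "i \<in> I" "\<not> small (Z i)" by blast
  obtain c e where ce: "i = (c, e)" by (cases i)
  then have "e > 0" using i(1) unfolding I_def by auto
  moreover have "\<not> small ({z \<in> X. dist (q z) c < e} \<inter> p -` supp p {z \<in> X. dist (q z) c > 2 * e})"
    using i(2) unfolding ce Z_def by simp
  ultimately show ?thesis by (rule that)
qed

text \<open>
  The open sets \<open>U j\<close> with \<open>j < m\<close> and \<open>d j = 0\<close> are the reservoirs of a leaf \<open>d\<close>, and \<open>U m\<close> is the set of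
  the leaf itself (\<open>d m = 0\<close>). A point in \<open>reach d U (Suc m)\<close> is approximated by non-small parts of
  \<open>U m\<close>, whose points are approximated by non-small parts of the last reservoir, and so on.
\<close>

fun reach :: "(nat \<Rightarrow> nat) \<Rightarrow> (nat \<Rightarrow> (nat \<Rightarrow> nat) set) \<Rightarrow> nat \<Rightarrow> 'a set" where
  "reach d U 0 = UNIV"
| "reach d U (Suc j) = (if d j = 0 then supp p (U j \<inter> p -` reach d U j) else reach d U j)"

section \<open>Reachability: monotonicity, unions and cluster points\<close>

lemma reach_cong:
  "(\<And>i. i < j \<Longrightarrow> d i = 0 \<longleftrightarrow> d' i = 0) \<Longrightarrow> (\<And>i. i < j \<Longrightarrow> d i = 0 \<Longrightarrow> U i = U' i) \<Longrightarrow>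
    reach d U j = reach d' U' j"
  by (induction j) auto

lemma closed_reach: "closed (reach d U j)"
  by (induction j) (auto simp: closed_supp)

text \<open>The support of parameters whose \<open>p\<close>-values lie in a closed set stays inside
  that set.\<close>

lemma reach_antimono: "j \<le> j' \<Longrightarrow> reach d U j' \<subseteq> reach d U j"
proof (induction rule: dec_induct)
  case (step n)
  have "reach d U (Suc n) \<subseteq> reach d U n"
    using supp_subset_closed[OF closed_reach] by auto
  then show ?case using step by blast
qed simp

text \<open>Subadditivity of supports carries the splitting of one reservoir up through all later
  positions.\<close>

lemma reach_Un:
  "reach d (U(i := S \<union> S')) j \<subseteq> reach d (U(i := S)) j \<union> reach d (U(i := S')) j"
proof (induction j)
  case (Suc j)
  show ?case
  proof (cases "d j = 0")
    case True
    have *: "(U(i := S \<union> S')) j \<inter> p -` reach d (U(i := S \<union> S')) j \<subseteq>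
       ((U(i := S)) j \<inter> p -` reach d (U(i := S)) j) \<union> ((U(i := S')) j \<inter> p -` reach d (U(i := S')) j)"
    proof (cases "j = i")
      case True
      then have "reach d (U(i := S \<union> S')) j = reach d U j" "reach d (U(i := S)) j = reach d U j"
        "reach d (U(i := S')) j = reach d U j"
        by (simp_all cong: reach_cong)
      then show ?thesis using True by auto
    next
      case False
      then show ?thesis using Suc by (simp del: fun_upd_apply add: fun_upd_other) blast
    qed
    have "reach d (U(i := S \<union> S')) (Suc j) = supp p ((U(i := S \<union> S')) j \<inter> p -` reach d (U(i := S \<union> S')) j)"
      using True by (simp del: fun_upd_apply)
    also have "\<dots> \<subseteq> supp p ((U(i := S)) j \<inter> p -` reach d (U(i := S)) j)
        \<union> supp p ((U(i := S')) j \<inter> p -` reach d (U(i := S')) j)"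
      using supp_mono[OF *, of p] supp_Un by (rule order_trans)
    finally show ?thesis using True by (simp del: fun_upd_apply)
  qed (use Suc in simp)
qed simp

lemma reach_empty: "d i = 0 \<Longrightarrow> i < j \<Longrightarrow> reach d (U(i := {})) j = {}"
  using reach_antimono[of "Suc i" j d "U(i := {})"] by auto

text \<open>Otherwise every \<open>y\<close> has a ball through which \<open>x\<close> cannot be
  reached. Finitely many such balls cover \<open>K\<close>, which contains all
  \<open>q\<close>-values, so by \<open>reach_Un\<close> the full reservoir would not reach
  \<open>x\<close> either.\<close>

lemma reach_cluster_point:
  assumes x: "x \<in> reach d U j" and i: "d i = 0" "i < j"
  obtains y where "\<And>r. r > 0 \<Longrightarrow> x \<in> reach d (U(i := U i \<inter> q -` ball y r)) j"
proof -
  have "\<exists>y. \<forall>r>0. x \<in> reach d (U(i := U i \<inter> q -` ball y r)) j"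
  proof (rule ccontr)
    assume "\<not> ?thesis"
    then obtain r where r: "\<And>y. r y > 0" "\<And>y. x \<notin> reach d (U(i := U i \<inter> q -` ball y (r y))) j"
      by metis
    have "K \<subseteq> (\<Union>y\<in>K. ball y (r y))" using r(1) by force
    then obtain F where F: "finite F" "K \<subseteq> (\<Union>y\<in>F. ball y (r y))"
      by (rule compactE_image[OF compact_K, rotated]) simp_all
    have "x \<notin> reach d (U(i := U i \<inter> q -` (\<Union>y\<in>F. ball y (r y)))) j"
      using F(1)
    proof induction
      case empty
      then show ?case using reach_empty[of d i j U] i by (simp del: fun_upd_apply)
    next
      case (insert y F)
      let ?S = "U i \<inter> q -` ball y (r y)"
      let ?S' = "U i \<inter> q -` (\<Union>y\<in>F. ball y (r y))"
      have "U i \<inter> q -` (\<Union>y\<in>insert y F. ball y (r y)) = ?S \<union> ?S'" by auto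
      moreover have "x \<notin> reach d (U(i := ?S \<union> ?S')) j"
        using reach_Un[of d U i ?S ?S' j] insert.IH r(2)[of y] by blast
      ultimately show ?case by metis
    qed
    moreover have "U i \<inter> q -` (\<Union>y\<in>F. ball y (r y)) = U i" using F(2) q_in_K by blast
    ultimately show False using x by simp
  qed
  then show ?thesis using that by blast
qed

section \<open>Separation under \<open>q\<close> and the choice of fresh parameters\<close>

definition separated :: "real \<Rightarrow> (nat \<Rightarrow> nat) set \<Rightarrow> (nat \<Rightarrow> nat) set \<Rightarrow> bool" where
  "separated r S S' \<longleftrightarrow> (\<forall>z\<in>S. \<forall>z'\<in>S'. r \<le> dist (q z) (q z'))"

lemma separated_mono:
  "separated r S S' \<Longrightarrow> T \<subseteq> S \<Longrightarrow> T' \<subseteq> S' \<Longrightarrow> r' \<le> r \<Longrightarrow> separated r' T T'"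
  unfolding separated_def by (meson order_trans subsetD)

lemma separated_sym: "separated r S S' \<longleftrightarrow> separated r S' S"
  unfolding separated_def by (metis dist_commute)

text \<open>Fills the positions from \<open>a\<close> to \<open>c\<close> out of the single open set
  \<open>W\<close>. At each zero coordinate before \<open>c\<close>, \<open>split_nonsmall\<close>
  cuts off a reservoir and leaves a part at positive \<open>q\<close>-distance that is still
  non-small over the support of the reservoir. This part is cut further, and the remainder becomes
  the set at \<open>c\<close>.\<close>

lemma chain_extension:
  assumes "\<not> small (W \<inter> p -` reach d U a)" "open W" "a \<le> c" "d c = 0"
  shows "\<exists>F. (\<forall>j. open (F j) \<and> F j \<subseteq> W) \<and>
     (\<exists>r>0. \<forall>i j. a \<le> i \<and> i \<noteq> j \<and> a \<le> j \<longrightarrow> separated r (F i) (F j)) \<and>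
     reach d (\<lambda>j. if j < a then U j else F j) (Suc c) \<noteq> {}"
  using assms(3,1,2)
proof (induction arbitrary: U W rule: inc_induct)
  case base
  let ?F = "(\<lambda>_. {})(c := W)"
  have "reach d (\<lambda>j. if j < c then U j else ?F j) c = reach d U c"
    by (rule reach_cong) auto
  then have "reach d (\<lambda>j. if j < c then U j else ?F j) (Suc c) \<noteq> {}"
    using base assms(4) supp_nonempty[of "W \<inter> p -` reach d U c" p] by simp
  then show ?case using base
    by (intro exI[of _ ?F]) (auto simp: separated_def intro: exI[of _ 1])
next
  case (step a)
  have "\<exists>Wa W' s. open Wa \<and> Wa \<subseteq> W \<and> open W' \<and> W' \<subseteq> W \<and> s > 0 \<and> separated s Wa W' \<and>
     \<not> small (W' \<inter> p -` reach d (U(a := Wa)) (Suc a))"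
  proof (cases "d a = 0")
    case True
    let ?B = "p -` reach d U a"
    let ?X = "W \<inter> ?B"
    \<comment> \<open>Here \<open>c\<close> is a centre in the range space, not the last position.
      The far part \<open>?Wa\<close> becomes the reservoir at \<open>a\<close>, and the near part
      \<open>?W'\<close> feeds the later positions.\<close>
    obtain c e where ce: "e > 0"
        "\<not> small ({z \<in> ?X. dist (q z) c < e} \<inter> p -` supp p {z \<in> ?X. dist (q z) c > 2 * e})"
      using split_nonsmall[OF step.prems(1)] .
    let ?Wa = "W \<inter> q -` {y. dist y c > 2 * e}"
    let ?W' = "W \<inter> q -` {y. dist y c < e}"
    have r: "reach d (U(a := ?Wa)) a = reach d U a" by (rule reach_cong) auto
    have far: "{z \<in> ?X. dist (q z) c > 2 * e} = ?Wa \<inter> ?B" by auto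
    have "reach d (U(a := ?Wa)) (Suc a) = supp p (?Wa \<inter> ?B)"
      unfolding r[symmetric] using True by simp
    then have "{z \<in> ?X. dist (q z) c < e} \<inter> p -` supp p {z \<in> ?X. dist (q z) c > 2 * e}
        \<subseteq> ?W' \<inter> p -` reach d (U(a := ?Wa)) (Suc a)"
      unfolding far by auto
    then have "\<not> small (?W' \<inter> p -` reach d (U(a := ?Wa)) (Suc a))"
      using ce(2) small_subset by blast
    moreover have "open ?Wa" "open ?W'"
      by (intro open_Int open_q_vimage step.prems(2) open_Collect_less continuous_intros)+
    moreover have "separated e ?Wa ?W'"
      unfolding separated_def
    proof (intro ballI)
      fix z z' assume "z \<in> ?Wa" "z' \<in> ?W'"
      then show "e \<le> dist (q z) (q z')" using dist_triangle[of "q z" c "q z'"] by simp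
    qed
    ultimately show ?thesis using ce(1) by blast
  next
    \<comment> \<open>A nonzero coordinate carries no reservoir: \<open>W\<close> is passed on
      whole, and the gap \<open>1\<close> is arbitrary.\<close>
    case False
    have "reach d (U(a := {})) (Suc a) = reach d U a"
      using False by (simp, intro reach_cong) auto
    then show ?thesis using step.prems
      by (intro exI[of _ "{}"] exI[of _ W] exI[of _ 1]) (simp add: separated_def)
  qed
  then obtain Wa W' s where W: "open Wa" "Wa \<subseteq> W" "open W'" "W' \<subseteq> W" "s > 0" "separated s Wa W'"
     "\<not> small (W' \<inter> p -` reach d (U(a := Wa)) (Suc a))" by blast
  obtain F r where F: "\<forall>j. open (F j) \<and> F j \<subseteq> W'" "r > 0"
     "\<forall>i j. Suc a \<le> i \<and> i \<noteq> j \<and> Suc a \<le> j \<longrightarrow> separated r (F i) (F j)"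
     "reach d (\<lambda>j. if j < Suc a then (U(a := Wa)) j else F j) (Suc c) \<noteq> {}"
    using step.IH[OF W(7,3)] by blast
  let ?F = "F(a := Wa)"
  have "(\<lambda>j. if j < Suc a then (U(a := Wa)) j else F j) = (\<lambda>j. if j < a then U j else ?F j)"
    by (auto simp: fun_eq_iff)
  then have "reach d (\<lambda>j. if j < a then U j else ?F j) (Suc c) \<noteq> {}" using F(4) by simp
  moreover have "separated (min r s) (?F i) (?F j)" if "a \<le> i" "i \<noteq> j" "a \<le> j" for i j
  proof (cases "i = a \<or> j = a")
    case True
    have *: "separated (min r s) Wa (F k)" for k
      by (rule separated_mono[OF W(6)]) (use F(1) in auto)
    show ?thesis
    proof (cases "i = a")
      case True
      then show ?thesis using * that by simp
    next
      case False
      then show ?thesis using * separated_sym \<open>i = a \<or> j = a\<close> by simp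
    qed
  next
    case False
    then have "separated r (?F i) (?F j)" using F(3) that by simp
    then show ?thesis by (rule separated_mono) auto
  qed
  ultimately show ?case using W(1,2,4,5) F(1,2)
    by (intro exI[of _ ?F] conjI exI[of _ "min r s"] allI impI) (simp_all, blast)
qed

text \<open>The points are picked one at a time: the parameters with a forbidden
  \<open>q\<close>-value and those of \<open>X d\<close> outside its support form small sets, which
  cannot exhaust \<open>X d\<close>.\<close>

lemma distinct_points:
  assumes "finite D" "finite F" "\<And>d. d \<in> D \<Longrightarrow> \<not> small (X d)"
  shows "\<exists>z. (\<forall>d\<in>D. z d \<in> X d \<inter> supp id (X d) \<and> q (z d) \<notin> F) \<and> inj_on (\<lambda>d. q (z d)) D"
  using assms(1,3)
proof (induction rule: finite_induct)
  case (insert d D)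
  then obtain z where z: "\<forall>d\<in>D. z d \<in> X d \<inter> supp id (X d) \<and> q (z d) \<notin> F" "inj_on (\<lambda>d. q (z d)) D"
    by (metis insertI2)
  let ?G = "F \<union> (\<lambda>d. q (z d)) ` D"
  have "small (q -` ?G)" using insert assms(2) by (intro small_q_preimage_finite) auto
  then have "small (q -` ?G \<union> (X d - id -` supp id (X d)))"
    by (intro small_Un small_outside_supp)
  then have "X d - (q -` ?G \<union> (X d - id -` supp id (X d))) \<noteq> {}"
    using not_small_Diff[of "X d"] insert.prems by (metis insertI1 small_empty)
  then obtain w where w: "w \<in> X d" "w \<in> supp id (X d)" "q w \<notin> ?G" by auto
  have "inj_on (\<lambda>e. q ((z(d := w)) e)) (insert d D)"
  proof -
    have "inj_on (\<lambda>e. q ((z(d := w)) e)) D \<longleftrightarrow> inj_on (\<lambda>e. q (z e)) D"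
      by (rule inj_on_cong) (use insert.hyps(2) in auto)
    moreover have "(\<lambda>e. q ((z(d := w)) e)) ` (D - {d}) = (\<lambda>e. q (z e)) ` D"
      by (rule image_cong) (use insert.hyps(2) in auto)
    ultimately show ?thesis using z(2) w(3) by (simp add: inj_on_insert del: fun_upd_apply) simp
  qed
  moreover have "\<forall>e\<in>insert d D. (z(d := w)) e \<in> X e \<inter> supp id (X e) \<and> q ((z(d := w)) e) \<notin> F"
  proof
    fix e assume "e \<in> insert d D"
    show "(z(d := w)) e \<in> X e \<inter> supp id (X e) \<and> q ((z(d := w)) e) \<notin> F"
    proof (cases "e = d")
      case True
      then show ?thesis using w by simp
    next
      case False
      then have "e \<in> D" "(z(d := w)) e = z e" using \<open>e \<in> insert d D\<close> by auto
      then show ?thesis using z(1) by metis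
    qed
  qed
  ultimately show ?case by (intro exI[of _ "z(d := w)"] conjI)
qed simp

text \<open>Provides the open sets from which new copies are carved: neighbourhoods, within the
  reservoirs, of points with distinct \<open>q\<close>-values outside \<open>F\<close>. The points
  lie in supports for \<open>id\<close>, which keeps the neighbourhoods non-small.\<close>

lemma fresh_pieces:
  fixes U :: "(nat \<Rightarrow> nat) \<Rightarrow> nat \<Rightarrow> (nat \<Rightarrow> nat) set"
  assumes fin: "finite D" "finite F" and e: "e > 0"
    and op: "\<And>d. d \<in> D \<Longrightarrow> open (U d i)"
    and x: "\<And>d. d \<in> D \<Longrightarrow> x d \<in> supp p (U d i \<inter> p -` reach d (U d) i)"
  obtains W r where "r > 0" "\<And>d. d \<in> D \<Longrightarrow> open (W d)" "\<And>d. d \<in> D \<Longrightarrow> W d \<subseteq> U d i"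
    "\<And>d. d \<in> D \<Longrightarrow> p ` W d \<subseteq> ball (x d) e" "\<And>d. d \<in> D \<Longrightarrow> \<exists>z. W d \<subseteq> cylinder n z"
    "\<And>d. d \<in> D \<Longrightarrow> \<not> small (W d \<inter> p -` reach d (U d) i)"
    "\<And>d y. d \<in> D \<Longrightarrow> y \<in> F \<Longrightarrow> separated r (q -` ball y r) (W d)"
    "\<And>d d'. d \<in> D \<Longrightarrow> d' \<in> D \<Longrightarrow> d \<noteq> d' \<Longrightarrow> separated r (W d) (W d')"
proof -
  define X where "X = (\<lambda>d. U d i \<inter> p -` reach d (U d) i \<inter> p -` ball (x d) e)"
  have "\<not> small (X d)" if "d \<in> D" for d
    using x[OF that] e unfolding supp_def X_def by (metis (mono_tags, lifting) centre_in_ball mem_Collect_eq open_ball)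
  then obtain z where z: "\<forall>d\<in>D. z d \<in> X d \<inter> supp id (X d) \<and> q (z d) \<notin> F" "inj_on (\<lambda>d. q (z d)) D"
    using distinct_points[OF fin, of X] by blast
  obtain s where s: "s > 0" "\<And>x y. x \<in> F \<union> (\<lambda>d. q (z d)) ` D \<Longrightarrow> y \<in> F \<union> (\<lambda>d. q (z d)) ` D \<Longrightarrow>
      x \<noteq> y \<Longrightarrow> s \<le> dist x y"
    using finite_separated[of "F \<union> (\<lambda>d. q (z d)) ` D"] fin by auto
  \<comment> \<open>Balls of radius \<open>s / 3\<close> about points at distance at least
    \<open>s\<close> leave a gap of \<open>s / 3\<close>.\<close>
  define r where "r = s / 3"
  define O' where "O' = (\<lambda>d. q -` ball (q (z d)) r \<inter> cylinder n (z d))"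
  define W where "W = (\<lambda>d. U d i \<inter> p -` ball (x d) e \<inter> O' d)"
  have r: "r > 0" using s(1) by (simp add: r_def)
  have opO: "open (O' d)" for d
    unfolding O'_def by (intro open_Int open_q_vimage open_ball open_cylinder)
  have sep: "separated r (q -` ball a r) (q -` ball b r)"
    if "a \<noteq> b" "a \<in> F \<union> (\<lambda>d. q (z d)) ` D" "b \<in> F \<union> (\<lambda>d. q (z d)) ` D" for a b
    unfolding separated_def
  proof (intro ballI)
    fix v w assume vw: "v \<in> q -` ball a r" "w \<in> q -` ball b r"
    have "3 * r \<le> dist a b" using s(2) that unfolding r_def by auto
    also have "dist a b \<le> dist a (q v) + dist (q v) (q w) + dist (q w) b"
      using dist_triangle[of a b "q v"] dist_triangle[of "q v" b "q w"] by linarith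
    finally show "r \<le> dist (q v) (q w)" using vw by (simp add: dist_commute)
  qed
  show ?thesis
  proof (rule that[of r W])
    show "open (W d)" if "d \<in> D" for d
      unfolding W_def by (intro open_Int open_p_vimage op opO that open_ball)
    show "\<not> small (W d \<inter> p -` reach d (U d) i)" if "d \<in> D" for d
    proof -
      have "z d \<in> O' d" by (simp add: O'_def r)
      moreover have "z d \<in> supp id (X d)" using z that by blast
      ultimately have "\<not> small (X d \<inter> id -` O' d)" using opO unfolding supp_def by blast
      moreover have "X d \<inter> id -` O' d = W d \<inter> p -` reach d (U d) i"
        unfolding X_def W_def by auto
      ultimately show ?thesis by simp
    qed
    show "separated r (q -` ball y r) (W d)" if "d \<in> D" "y \<in> F" for d y
      by (rule separated_mono[OF sep[of y "q (z d)"]]) (use that z in \<open>auto simp: W_def O'_def\<close>)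
    show "separated r (W d) (W d')" if "d \<in> D" "d' \<in> D" "d \<noteq> d'" for d d'
      by (rule separated_mono[OF sep[of "q (z d)" "q (z d')"]])
        (use that z(2) in \<open>auto simp: W_def O'_def inj_on_def\<close>)
  qed (use r in \<open>auto simp: W_def O'_def\<close>)
qed

end

subsection \<open>Refining a stage\<close>

definition leaves :: "(nat \<Rightarrow> nat) \<Rightarrow> (nat \<Rightarrow> nat) set" where
  "leaves b = {d. \<forall>j. d j \<le> b j}"

lemma leaves_le: "d \<in> leaves b \<Longrightarrow> d j \<le> b j"
  by (simp add: leaves_def)

lemma leaves_eq_0: "d \<in> leaves b \<Longrightarrow> b j = 0 \<Longrightarrow> d j = 0"
  using leaves_le[of d b j] by simp

definition agree :: "nat \<Rightarrow> (nat \<Rightarrow> nat) \<Rightarrow> (nat \<Rightarrow> nat) \<Rightarrow> bool" where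
  "agree n d e \<longleftrightarrow> (\<forall>t<n. d t = e t)"

lemma finite_leaves:
  assumes "\<And>j. j \<ge> m \<Longrightarrow> b j = 0"
  shows "finite (leaves b)"
proof (rule finite_subset)
  show "leaves b \<subseteq> {f. \<forall>x. (x \<in> {..<m} \<longrightarrow> f x \<in> (\<Union>j<m. {..b j})) \<and> (x \<notin> {..<m} \<longrightarrow> f x = 0)}"
    using assms by (auto simp: not_less leaves_eq_0 dest: leaves_le)
  show "finite {f. \<forall>x. (x \<in> {..<m} \<longrightarrow> f x \<in> (\<Union>j<m. {..b j})) \<and> (x \<notin> {..<m} \<longrightarrow> f x = 0)}"
    by (rule finite_set_of_finite_funs) auto
qed

text \<open>
  A refinement at \<open>c < m\<close> allows the new value \<open>b c + 1\<close> at coordinate \<open>c\<close>; at \<open>c = m\<close> it adds a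
  coordinate. The second case is treated as if every leaf were a new copy of itself. Over the new
  leaf \<open>e\<close>, the set in position \<open>j\<close> is contained in the old set of \<open>parent e\<close> in position \<open>place e j\<close>.
\<close>

definition depth' :: "nat \<Rightarrow> nat \<Rightarrow> nat" where
  "depth' c m = (if c < m then m else Suc m)"

definition bound' :: "nat \<Rightarrow> nat \<Rightarrow> (nat \<Rightarrow> nat) \<Rightarrow> nat \<Rightarrow> nat" where
  "bound' c m b = (if c < m then b(c := Suc (b c)) else b)"

definition copies :: "nat \<Rightarrow> nat \<Rightarrow> (nat \<Rightarrow> nat) \<Rightarrow> (nat \<Rightarrow> nat) set" where
  "copies c m b = (if c < m then {e. e c = Suc (b c)} else UNIV)"

definition parent :: "nat \<Rightarrow> (nat \<Rightarrow> nat) set \<Rightarrow> (nat \<Rightarrow> nat) \<Rightarrow> nat \<Rightarrow> nat" where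
  "parent c N e = (if e \<in> N then e(c := 0) else e)"

definition place :: "nat \<Rightarrow> (nat \<Rightarrow> nat) set \<Rightarrow> (nat \<Rightarrow> nat) \<Rightarrow> nat \<Rightarrow> nat" where
  "place c N e j = (if e \<in> N then min j c else j)"

context parametrized_function
begin

text \<open>
  The pair \<open>(d, i)\<close> stands for the path that follows \<open>d\<close> below \<open>i\<close> and then takes a value that is not
  yet present. Sets on different paths are separated under \<open>q\<close>.
\<close>

definition state where
  "state m b U x \<longleftrightarrow> (\<forall>j\<ge>m. b j = 0) \<and>
     (\<forall>d\<in>leaves b. (\<forall>j\<le>m. open (U d j) \<and> (d j \<noteq> 0 \<longrightarrow> U d j = {})) \<and> x d \<in> reach d (U d) (Suc m)) \<and>
     (\<exists>r>0. \<forall>d\<in>leaves b. \<forall>e\<in>leaves b. \<forall>i\<le>m. \<forall>j\<le>m.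
        \<not> (i = j \<and> agree i d e) \<longrightarrow> separated r (U d i) (U e j))"

text \<open>Used at stage \<open>n\<close> with \<open>e = (1/2) ^ n\<close>: the bound on
  \<open>x'\<close> makes the centres along a branch a Cauchy sequence, and the cylinders shrink the
  nested sets of a branch to one parameter.\<close>

definition refines where
  "refines c m b n e U x U' x' \<longleftrightarrow> (\<forall>d\<in>leaves (bound' c m b).
     dist (x' d) (x (parent c (copies c m b) d)) \<le> e \<and>
     (\<forall>j\<le>depth' c m. U' d j \<subseteq> U (parent c (copies c m b) d) (place c (copies c m b) d j) \<and>
        (d \<in> copies c m b \<and> c \<le> j \<longrightarrow>
           (\<exists>z. U' d j \<subseteq> cylinder n z) \<and> p ` U' d j \<subseteq> cball (x (parent c (copies c m b) d)) e)))"

lemma supp_subset: "closed C \<Longrightarrow> p ` S \<subseteq> C \<Longrightarrow> supp p S \<subseteq> C"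
  using supp_subset_closed[of C p S] by (simp add: image_subset_iff_subset_vimage Int_absorb2)

text \<open>Each leaf with \<open>d c = 0\<close> produces a copy, housed in a fresh piece of its
  reservoir at \<open>c\<close>. For \<open>c < m\<close> the remaining reservoirs at
  \<open>c\<close> shrink to preimages of balls about cluster points, which the pieces avoid. A copy
  inherits the sets below \<open>c\<close> and gets the others, inside its piece, from
  \<open>chain_extension\<close>.\<close>

lemma refinement_exists:
  fixes U :: "(nat \<Rightarrow> nat) \<Rightarrow> nat \<Rightarrow> (nat \<Rightarrow> nat) set" and e :: real
  assumes st: "state m b U x" and c: "c \<le> m" and e: "e > 0"
  obtains U' x' where "state (depth' c m) (bound' c m b) U' x'" "refines c m b n e U x U' x'"
proof -
  define m' b' N where "m' = depth' c m" and "b' = bound' c m b" and "N = copies c m b"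
  note defs = m'_def b'_def N_def depth'_def bound'_def copies_def
  have b0: "\<And>j. j \<ge> m \<Longrightarrow> b j = 0" using st unfolding state_def by blast
  have op: "\<And>d j. d \<in> leaves b \<Longrightarrow> j \<le> m \<Longrightarrow> open (U d j)"
    and emp: "\<And>d j. d \<in> leaves b \<Longrightarrow> j \<le> m \<Longrightarrow> d j \<noteq> 0 \<Longrightarrow> U d j = {}"
    and x: "\<And>d. d \<in> leaves b \<Longrightarrow> x d \<in> reach d (U d) (Suc m)"
    using st unfolding state_def by (simp_all del: reach.simps)
  obtain r0 where r0: "r0 > 0" "\<forall>d\<in>leaves b. \<forall>e\<in>leaves b. \<forall>i\<le>m. \<forall>j\<le>m.
      \<not> (i = j \<and> agree i d e) \<longrightarrow> separated r0 (U d i) (U e j)"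
    using st[unfolded state_def, THEN conjunct2, THEN conjunct2] by (elim exE conjE) (rule that)
  have cm': "c \<le> m'" "m \<le> m'" using c by (auto simp: defs)
  have b'0: "b' j = 0" if "j \<ge> m'" for j
    using that b0 c by (auto simp: defs split: if_splits)
  have old: "d \<in> leaves b \<and> m' = m \<and> c < m" if "d \<in> leaves b'" "d \<notin> N" for d
  proof -
    have cm: "c < m" and dc: "d c \<noteq> Suc (b c)" using that(2) by (auto simp: defs split: if_splits)
    have "d j \<le> b j" for j
    proof (cases "j = c")
      case True
      then show ?thesis using leaves_le[OF that(1), of j] cm dc by (simp add: defs)
    next
      case False
      then show ?thesis using leaves_le[OF that(1), of j] cm by (simp add: defs)
    qed
    then show ?thesis using cm by (simp add: leaves_def defs)
  qed
  have new: "d(c := 0) \<in> leaves b" if "d \<in> leaves b'" for d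
    using that unfolding leaves_def defs by (auto split: if_splits)
  \<comment> \<open>A copy is determined by its parent: its value at \<open>c\<close> is
    \<open>Suc (b c)\<close> if \<open>c < m\<close>, and \<open>0\<close> if
    \<open>c = m\<close>.\<close>
  have new_eq: "d = d'" if "d \<in> leaves b'" "d' \<in> leaves b'" "d \<in> N" "d' \<in> N" "d(c := 0) = d'(c := 0)" for d d'
  proof -
    have "d c = d' c"
    proof (cases "c < m")
      case True
      then show ?thesis using that(3,4) by (simp add: defs)
    next
      case False
      then have "b' c = 0" using c b0 by (simp add: defs)
      then show ?thesis using that(1,2) by (simp add: leaves_eq_0)
    qed
    then show ?thesis using that(5) by (metis fun_upd_triv fun_upd_upd)
  qed
  define D where "D = {d \<in> leaves b. d c = 0}"
  have finD: "finite D" using finite_leaves[OF b0] unfolding D_def by simp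
  \<comment> \<open>The cluster point serves every radius at once, so the radius can be fixed later,
    when the fresh pieces avoiding \<open>y\<close> have been found.\<close>
  have "\<forall>d\<in>D. \<exists>y. \<forall>r>0. x d \<in> reach d ((U d)(c := U d c \<inter> q -` ball y r)) (Suc m)"
    using reach_cluster_point[of "x _" _ "U _" "Suc m" c] x c unfolding D_def
    by (metis (mono_tags, lifting) le_imp_less_Suc mem_Collect_eq)
  then obtain y where y: "\<And>d r. d \<in> D \<Longrightarrow> r > 0 \<Longrightarrow>
      x d \<in> reach d ((U d)(c := U d c \<inter> q -` ball (y d) r)) (Suc m)" by metis
  have xc: "x d \<in> supp p (U d c \<inter> p -` reach d (U d) c)" if "d \<in> D" for d
    using x[of d] reach_antimono[of "Suc c" "Suc m" d "U d"] c that unfolding D_def by auto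
  obtain W r where W: "r > 0" "\<And>d. d \<in> D \<Longrightarrow> open (W d)" "\<And>d. d \<in> D \<Longrightarrow> W d \<subseteq> U d c"
    "\<And>d. d \<in> D \<Longrightarrow> p ` W d \<subseteq> ball (x d) e" "\<And>d. d \<in> D \<Longrightarrow> \<exists>z. W d \<subseteq> cylinder n z"
    "\<And>d. d \<in> D \<Longrightarrow> \<not> small (W d \<inter> p -` reach d (U d) c)"
    "\<And>d z. d \<in> D \<Longrightarrow> z \<in> y ` D \<Longrightarrow> separated r (q -` ball z r) (W d)"
    "\<And>d d'. d \<in> D \<Longrightarrow> d' \<in> D \<Longrightarrow> d \<noteq> d' \<Longrightarrow> separated r (W d) (W d')"
    by (rule fresh_pieces[OF finD finite_imageI[OF finD] e, where n = n and U = U and i = c and x = x])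
      (use op xc c in \<open>auto simp: D_def\<close>)
  define par where "par = (\<lambda>d :: nat \<Rightarrow> nat. d(c := 0))"
  have parD: "par d \<in> D" if "d \<in> leaves b'" for d using new[OF that] by (simp add: par_def D_def)
  have "\<forall>d\<in>leaves b'. \<exists>F. (\<forall>j. open (F j) \<and> F j \<subseteq> W (par d)) \<and>
     (\<exists>s>0. \<forall>i j. c \<le> i \<and> i \<noteq> j \<and> c \<le> j \<longrightarrow> separated s (F i) (F j)) \<and>
     reach d (\<lambda>j. if j < c then U (par d) j else F j) (Suc m') \<noteq> {}"
  proof
    fix d assume d: "d \<in> leaves b'"
    have "reach d (U (par d)) c = reach (par d) (U (par d)) c"
      by (rule reach_cong) (auto simp: par_def)
    then have ns: "\<not> small (W (par d) \<inter> p -` reach d (U (par d)) c)" using W(6) parD[OF d] by simp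
    have "d m' = 0" using leaves_eq_0[OF d b'0] by simp
    then show "\<exists>F. (\<forall>j. open (F j) \<and> F j \<subseteq> W (par d)) \<and>
     (\<exists>s>0. \<forall>i j. c \<le> i \<and> i \<noteq> j \<and> c \<le> j \<longrightarrow> separated s (F i) (F j)) \<and>
     reach d (\<lambda>j. if j < c then U (par d) j else F j) (Suc m') \<noteq> {}"
      by (rule chain_extension[OF ns W(2)[OF parD[OF d]] cm'(1)])
  qed
  then obtain F where F: "\<And>d j. d \<in> leaves b' \<Longrightarrow> open (F d j)" "\<And>d j. d \<in> leaves b' \<Longrightarrow> F d j \<subseteq> W (par d)"
     "\<And>d. d \<in> leaves b' \<Longrightarrow> \<exists>s>0. \<forall>i j. c \<le> i \<and> i \<noteq> j \<and> c \<le> j \<longrightarrow> separated s (F d i) (F d j)"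
     "\<And>d. d \<in> leaves b' \<Longrightarrow> reach d (\<lambda>j. if j < c then U (par d) j else F d j) (Suc m') \<noteq> {}"
    unfolding bchoice_iff by blast
  obtain s where s: "\<And>d. d \<in> leaves b' \<Longrightarrow> s d > 0"
     "\<And>d i j. d \<in> leaves b' \<Longrightarrow> c \<le> i \<Longrightarrow> i \<noteq> j \<Longrightarrow> c \<le> j \<Longrightarrow> separated (s d) (F d i) (F d j)"
    using F(3) by metis
  define s' where "s' = Min (insert 1 (s ` leaves b'))"
  have fin': "finite (leaves b')" by (rule finite_leaves[OF b'0])
  have s': "s' > 0" "\<And>d. d \<in> leaves b' \<Longrightarrow> s' \<le> s d"
    using fin' s(1) unfolding s'_def by auto
  define U' where "U' = (\<lambda>d j. if d \<in> N then (if j < c then U (par d) j else if d j = 0 then F d j else {})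
      else if j = c then U d c \<inter> q -` ball (y d) r else U d j)"
  \<comment> \<open>A copy chooses a centre from its nonempty reachable set; a remaining leaf keeps
    its centre.\<close>
  define x' where "x' = (\<lambda>d. if d \<in> N then SOME w. w \<in> reach d (U' d) (Suc m') else x d)"
  have fresh: "U' d j \<subseteq> W (par d)" if "d \<in> leaves b'" "d \<in> N" "c \<le> j" for d j
    using F(2) that unfolding U'_def by auto
  have sub: "U' d j \<subseteq> U (parent c N d) (place c N d j)" if "d \<in> leaves b'" "j \<le> m'" for d j
  proof (cases "d \<in> N \<and> c \<le> j")
    case True
    then show ?thesis using fresh[OF that(1)] W(3)[OF parD[OF that(1)]]
      by (simp add: parent_def place_def min_absorb2 par_def) blast
  next
    case False
    then show ?thesis by (auto simp: U'_def parent_def place_def par_def)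
  qed
  have x'in: "x' d \<in> reach d (U' d) (Suc m')" if d: "d \<in> leaves b'" for d
  proof (cases "d \<in> N")
    case True
    have "reach d (U' d) (Suc m') = reach d (\<lambda>j. if j < c then U (par d) j else F d j) (Suc m')"
      by (rule reach_cong) (auto simp: U'_def True)
    then show ?thesis using F(4)[OF d] True unfolding x'_def by (metis some_in_eq)
  next
    case False
    then have dl: "d \<in> leaves b" "m' = m" "c < m" using old[OF d] by auto
    show ?thesis
    proof (cases "d c = 0")
      case True
      have "U' d = (U d)(c := U d c \<inter> q -` ball (y d) r)"
        using False by (auto simp: U'_def fun_eq_iff)
      then show ?thesis using y[of d r] dl True W(1) False by (simp add: x'_def D_def)
    next
      case dc: False
      have "reach d (U' d) (Suc m') = reach d (U d) (Suc m)"
        unfolding dl(2) by (rule reach_cong) (use dc False in \<open>auto simp: U'_def\<close>)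
      then show ?thesis using x[OF dl(1)] False by (simp add: x'_def)
    qed
  qed
  define R where "R = min r0 (min r s')"
  have R: "R > 0" "R \<le> r0" "R \<le> r" "R \<le> s'" using r0(1) W(1) s'(1) by (auto simp: R_def)
  have pl: "place c N d j \<le> m" if "d \<in> leaves b'" "j \<le> m'" for d j
    using that old[OF that(1)] c by (auto simp: place_def)
  have parl: "parent c N d \<in> leaves b" if "d \<in> leaves b'" for d
    using that old[OF that] new[OF that] by (auto simp: parent_def)
  \<comment> \<open>The mixed case: a copy inside a fresh piece against the reservoir at
    \<open>c\<close> of a remaining leaf, which lies over a cluster ball or is empty.\<close>
  have half: "separated R (U' d i) (U' d' j)"
    if d: "d \<in> leaves b'" "d' \<in> leaves b'" "i \<le> m'" "j \<le> m'"
      and P: "place c N d i = place c N d' j" "agree (place c N d i) (parent c N d) (parent c N d')"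
      and f: "d \<in> N" "c \<le> i" "\<not> (d' \<in> N \<and> c \<le> j)" for d d' i j
  proof -
    have jc: "j = c" "d' \<notin> N" using P(1) f by (auto simp: place_def split: if_splits)
    have l: "d' \<in> leaves b" "m' = m" using old[OF d(2) jc(2)] by auto
    show ?thesis
    proof (cases "d' c = 0")
      case True
      then have "separated r (q -` ball (y d') r) (W (par d))"
        using l by (intro W(7) parD d(1)) (auto simp: D_def)
      then show ?thesis
        by (subst separated_sym, elim separated_mono) (use fresh[OF d(1) f(1,2)] R(3) jc in \<open>auto simp: U'_def\<close>)
    next
      case False
      then have "U' d' j = {}" using emp[OF l(1)] c jc by (simp add: U'_def)
      then show ?thesis by (simp add: separated_def)
    qed
  qed
  \<comment> \<open>Pairs from different old paths inherit \<open>r0\<close>. On the same old path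
    the gap comes from the cluster balls, from distinct fresh pieces, or from the chain of one
    copy.\<close>
  have sep: "separated R (U' d i) (U' d' j)"
    if d: "d \<in> leaves b'" "d' \<in> leaves b'" "i \<le> m'" "j \<le> m'" and ne: "\<not> (i = j \<and> agree i d d')" for d d' i j
  proof (cases "place c N d i = place c N d' j \<and> agree (place c N d i) (parent c N d) (parent c N d')")
    case False
    show ?thesis
      by (rule separated_mono[OF _ sub sub R(2)], rule r0(2)[rule_format]) (use False d pl parl in auto)
  next
    case P: True
    consider (nn) "\<not> (d \<in> N \<and> c \<le> i)" "\<not> (d' \<in> N \<and> c \<le> j)"
      | (fn) "d \<in> N" "c \<le> i" "\<not> (d' \<in> N \<and> c \<le> j)"
      | (nf) "\<not> (d \<in> N \<and> c \<le> i)" "d' \<in> N" "c \<le> j"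
      | (ff) "d \<in> N" "c \<le> i" "d' \<in> N" "c \<le> j" by blast
    then show ?thesis
    proof cases
      case nn
      have "i = j" using P nn by (auto simp: place_def split: if_splits)
      moreover have "agree i d d'"
        using P nn by (auto simp: place_def parent_def agree_def split: if_splits)
      ultimately show ?thesis using ne by blast
    next
      case fn
      show ?thesis by (rule half) (use d P fn in auto)
    next
      case nf
      have "agree (place c N d' j) (parent c N d') (parent c N d)"
        using P by (auto simp: agree_def)
      then have "separated R (U' d' j) (U' d i)" by (intro half) (use d P nf in auto)
      then show ?thesis by (subst separated_sym)
    next
      case ff
      show ?thesis
      proof (cases "par d = par d'")
        case True
        then have eq: "d = d'" using new_eq d ff by (simp add: par_def)
        then have "i \<noteq> j" using ne by (auto simp: agree_def)
        then have "separated (s d) (F d i) (F d j)" using s(2) d ff by blast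
        then show ?thesis
          by (rule separated_mono) (use ff eq s'(2)[OF d(1)] R(4) in \<open>auto simp: U'_def\<close>)
      next
        case False
        show ?thesis
          by (rule separated_mono[OF W(8)[OF parD parD False] fresh fresh R(3)]) (use d ff in auto)
      qed
    qed
  qed
  have opU': "open (U' d j)" and empU': "d j \<noteq> 0 \<longrightarrow> U' d j = {}" if d: "d \<in> leaves b'" "j \<le> m'" for d j
  proof -
    show "open (U' d j)"
    proof (cases "d \<in> N")
      case True
      then show ?thesis using F(1)[OF d(1)] op[OF new[OF d(1)], of j] c
        by (auto simp: U'_def par_def)
    next
      case False
      then show ?thesis using op[of d] old[OF d(1) False] d(2) c open_q_vimage[OF open_ball]
        by (auto simp: U'_def intro!: open_Int)
    qed
    show "d j \<noteq> 0 \<longrightarrow> U' d j = {}"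
    proof (cases "d \<in> N")
      case True
      then show ?thesis using emp[OF new[OF d(1)], of j] c
        by (auto simp: U'_def par_def)
    next
      case False
      then show ?thesis using emp[of d] old[OF d(1) False] d(2) c
        by (auto simp: U'_def)
    qed
  qed
  have "state m' b' U' x'"
    unfolding state_def
  proof (intro conjI ballI exI[of _ R])
    show "\<forall>j\<ge>m'. b' j = 0" using b'0 by blast
    show "\<forall>j\<le>m'. open (U' d j) \<and> (d j \<noteq> 0 \<longrightarrow> U' d j = {})" if "d \<in> leaves b'" for d
      using opU'[OF that] empU'[OF that] by blast
    show "x' d \<in> reach d (U' d) (Suc m')" if "d \<in> leaves b'" for d
      by (rule x'in[OF that])
    show "\<forall>i\<le>m'. \<forall>j\<le>m'. \<not> (i = j \<and> agree i d d') \<longrightarrow> separated R (U' d i) (U' d' j)"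
      if "d \<in> leaves b'" "d' \<in> leaves b'" for d d'
      using sep[OF that] by blast
  qed (rule R(1))
  moreover have "refines c m b n e U x U' x'"
    unfolding refines_def b'_def[symmetric] N_def[symmetric] m'_def[symmetric]
  proof (intro ballI conjI allI impI)
    fix d assume d: "d \<in> leaves b'"
    have cyl: "p ` U' d j \<subseteq> cball (x (parent c N d)) e" if "d \<in> N" "c \<le> j" for j
    proof -
      have "parent c N d = par d" using that(1) by (simp add: parent_def par_def)
      then show ?thesis
        using image_mono[OF fresh[OF d that], of p] W(4)[OF parD[OF d]]
          ball_subset_cball[of "x (par d)" e] by (metis order_trans)
    qed
    show "dist (x' d) (x (parent c N d)) \<le> e"
    proof (cases "d \<in> N")
      case True
      \<comment> \<open>The bound vanishes at \<open>m'\<close>, so the new centre lies in a support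
        of parameters whose \<open>p\<close>-values are in the closed ball.\<close>
      have "d m' = 0" using leaves_eq_0[OF d b'0] by simp
      then have "x' d \<in> supp p (U' d m' \<inter> p -` reach d (U' d) m')" using x'in[OF d] by simp
      moreover have "supp p (U' d m' \<inter> p -` reach d (U' d) m') \<subseteq> cball (x (parent c N d)) e"
        by (rule supp_subset) (use cyl[OF True cm'(1)] in auto)
      ultimately show ?thesis by (auto simp: dist_commute)
    next
      case False
      then show ?thesis using e by (simp add: x'_def parent_def)
    qed
    fix j assume j: "j \<le> m'"
    show "U' d j \<subseteq> U (parent c N d) (place c N d j)" by (rule sub[OF d j])
    assume "d \<in> N \<and> c \<le> j"
    then have dN: "d \<in> N" "c \<le> j" by auto
    show "\<exists>z. U' d j \<subseteq> cylinder n z" using fresh[OF d dN] W(5)[OF parD[OF d]] by blast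
    show "p ` U' d j \<subseteq> cball (x (parent c N d)) e" by (rule cyl[OF dN])
  qed
  ultimately show ?thesis using that unfolding m'_def b'_def by blast
qed

end

subsection \<open>The limit of the construction\<close>

text \<open>Values that are not yet present are sent to \<open>0\<close>, the limit point of a
  factor of the Cantor topology; this makes the fibres open there.\<close>

definition clip :: "nat \<Rightarrow> nat \<Rightarrow> nat" where
  "clip b k = (if k \<le> b then k else 0)"

lemma clip_le [simp]: "clip b k \<le> b"
  by (simp add: clip_def)

text \<open>The schedule: \<open>fst (prod_decode n)\<close> requests every coordinate infinitely
  often, and a request at or beyond the current depth adds one coordinate.\<close>

fun box :: "nat \<Rightarrow> nat \<times> (nat \<Rightarrow> nat)" where
  "box 0 = (0, \<lambda>_. 0)"
| "box (Suc n) = (let m = fst (box n); b = snd (box n); c = min (fst (prod_decode n)) m in (depth' c m, bound' c m b))"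

definition "depth n = fst (box n)"
definition "bound n = snd (box n)"
definition "site n = min (fst (prod_decode n)) (depth n)"

lemma depth_0: "depth 0 = 0" and bound_0: "bound 0 = (\<lambda>_. 0)"
  by (simp_all add: depth_def bound_def)

lemma depth_Suc: "depth (Suc n) = depth' (site n) (depth n)"
  and bound_Suc: "bound (Suc n) = bound' (site n) (depth n) (bound n)"
  by (simp_all add: depth_def bound_def site_def Let_def)

lemma site_le: "site n \<le> depth n"
  by (simp add: site_def)

lemma bound_beyond: "depth n \<le> j \<Longrightarrow> bound n j = 0"
  by (induction n) (auto simp: depth_0 bound_0 depth_Suc bound_Suc depth'_def bound'_def split: if_splits)

lemma depth_mono: "n \<le> n' \<Longrightarrow> depth n \<le> depth n'"
  by (rule lift_Suc_mono_le) (simp_all add: depth_Suc depth'_def)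

lemma bound_mono: "n \<le> n' \<Longrightarrow> bound n j \<le> bound n' j"
  by (rule lift_Suc_mono_le[of "\<lambda>n. bound n j"]) (simp_all add: bound_Suc bound'_def)

lemma site_recurrent: "\<exists>n\<ge>k. fst (prod_decode n) = i"
  by (intro exI[of _ "prod_encode (i, k)"]) (simp add: le_prod_encode_2)

lemma depth_unbounded: "\<exists>n. M \<le> depth n"
proof (induction M)
  case (Suc M)
  then obtain k where k: "M \<le> depth k" by blast
  show ?case
  proof (cases "Suc M \<le> depth k")
    case False
    then have dk: "depth k = M" using k by simp
    obtain n where n: "n \<ge> k" "fst (prod_decode n) = M" using site_recurrent by blast
    show ?thesis
    proof (cases "depth n = M")
      case True
      then have "depth (Suc n) = Suc M" using n(2) by (simp add: depth_Suc site_def depth'_def)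
      then show ?thesis by (intro exI[of _ "Suc n"]) simp
    next
      case False
      then show ?thesis using depth_mono[OF n(1)] dk by (intro exI[of _ n]) simp
    qed
  qed blast
qed simp

lemma bound_unbounded: "\<exists>n. M \<le> bound n j"
proof (induction M)
  case (Suc M)
  then obtain k where k: "M \<le> bound k j" by blast
  obtain l where l: "Suc j \<le> depth l" using depth_unbounded by blast
  obtain n where n: "n \<ge> max k l" "fst (prod_decode n) = j" using site_recurrent by blast
  have "j < depth n" using depth_mono[of l n] n(1) l by simp
  then have "bound (Suc n) j = Suc (bound n j)"
    using n(2) by (simp add: bound_Suc bound'_def site_def)
  moreover have "M \<le> bound n j" using bound_mono[of k n j] k n(1) by simp
  ultimately show ?case by (intro exI[of _ "Suc n"]) simp
qed simp

section \<open>The path of a point through the stages\<close>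

definition leaf :: "nat \<Rightarrow> (nat \<Rightarrow> nat) \<Rightarrow> nat \<Rightarrow> nat" where
  "leaf n x = (\<lambda>j. clip (bound n j) (x j))"

text \<open>
  \<open>level n x\<close> is the first coordinate at which \<open>x\<close> has a value not yet present at stage \<open>n\<close>; until that
  value appears, \<open>x\<close> is waiting in the corresponding reservoir of \<open>leaf n x\<close>.
\<close>

definition level :: "nat \<Rightarrow> (nat \<Rightarrow> nat) \<Rightarrow> nat" where
  "level n x = (LEAST l. l = depth n \<or> bound n l < x l)"

lemma leaf_in_leaves: "leaf n x \<in> leaves (bound n)"
  by (simp add: leaf_def leaves_def)

lemma level_le: "level n x \<le> depth n"
  unfolding level_def by (rule Least_le) simp

lemma below_level: "l < level n x \<Longrightarrow> x l \<le> bound n l"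
  using not_less_Least[of l "\<lambda>l. l = depth n \<or> bound n l < x l"] unfolding level_def by simp

lemma at_level: "level n x = depth n \<or> bound n (level n x) < x (level n x)"
  unfolding level_def by (rule LeastI[of _ "depth n"]) simp

lemma level_eqI:
  assumes "l \<le> depth n" "\<And>k. k < l \<Longrightarrow> x k \<le> bound n k" "l = depth n \<or> bound n l < x l"
  shows "level n x = l"
  unfolding level_def
proof (rule Least_equality)
  fix k assume "k = depth n \<or> bound n k < x k"
  then show "l \<le> k" using assms(1) assms(2)[of k] by (cases "k < l") auto
qed (rule assms(3))

text \<open>At its level, \<open>x\<close> is either cut off by the depth or has a value not yet
  present. The position therefore counts in \<open>reach\<close>, which makes its set nonempty in
  every stage.\<close>

lemma leaf_at_level: "leaf n x (level n x) = 0"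
  using at_level[of n x] bound_beyond[of n "level n x"] by (auto simp: leaf_def clip_def)

lemma leaf_step: "parent (site n) (copies (site n) (depth n) (bound n)) (leaf (Suc n) x) = leaf n x"
proof (cases "site n < depth n")
  case True
  then show ?thesis
    by (auto simp: fun_eq_iff parent_def copies_def leaf_def clip_def bound_Suc bound'_def)
next
  case False
  then have "site n = depth n" using site_le[of n] by simp
  then show ?thesis using bound_beyond[of n "depth n"]
    by (auto simp: fun_eq_iff parent_def copies_def leaf_def clip_def bound_Suc bound'_def)
qed

lemma level_step:
  "place (site n) (copies (site n) (depth n) (bound n)) (leaf (Suc n) x) (level (Suc n) x) = level n x"
proof (cases "site n < depth n")
  case True
  let ?c = "site n"
  have d: "depth (Suc n) = depth n" and b: "bound (Suc n) = (bound n)(?c := Suc (bound n ?c))"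
    using True by (simp_all add: depth_Suc depth'_def bound_Suc bound'_def)
  have N: "leaf (Suc n) x \<in> copies ?c (depth n) (bound n) \<longleftrightarrow> x ?c = Suc (bound n ?c)"
    using True by (auto simp: copies_def leaf_def clip_def b)
  have bw: "x k \<le> bound (Suc n) k" if "k < level n x" for k
    using below_level[OF that] by (auto simp: b)
  show ?thesis
  proof (cases "x ?c = Suc (bound n ?c)")
    case c: True
    have le: "level n x \<le> ?c"
      using below_level[of ?c n x] c by (cases "?c < level n x") auto
    show ?thesis
    proof (cases "level n x = ?c")
      case True
      have "?c \<le> level (Suc n) x"
      proof (rule ccontr)
        assume a: "\<not> ?c \<le> level (Suc n) x"
        then show False using at_level[of "Suc n" x] bw[of "level (Suc n) x"] True
          \<open>?c < depth n\<close> by (auto simp: d)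
      qed
      then show ?thesis using N c True by (simp add: place_def)
    next
      case False
      have "level (Suc n) x = level n x"
        by (rule level_eqI) (use False le at_level[of n x] level_le[of n x] bw \<open>?c < depth n\<close> in \<open>auto simp: d b\<close>)
      then show ?thesis using le by (simp add: place_def)
    qed
  next
    case False
    have "level (Suc n) x = level n x"
      by (rule level_eqI) (use False at_level[of n x] level_le[of n x] bw in \<open>auto simp: d b\<close>)
    then show ?thesis using N False by (simp add: place_def)
  qed
next
  case False
  then have c: "site n = depth n" using site_le[of n] by simp
  then have d: "depth (Suc n) = Suc (depth n)" and b: "bound (Suc n) = bound n"
    by (simp_all add: depth_Suc depth'_def bound_Suc bound'_def)
  have "min (level (Suc n) x) (depth n) = level n x"
  proof (cases "level n x = depth n")
    case True
    have "depth n \<le> level (Suc n) x"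
    proof (rule ccontr)
      assume a: "\<not> depth n \<le> level (Suc n) x"
      then show False using at_level[of "Suc n" x] below_level[of "level (Suc n) x" n x] True
        by (auto simp: d b)
    qed
    then show ?thesis using True by simp
  next
    case False
    have "level (Suc n) x = level n x"
      by (rule level_eqI) (use False at_level[of n x] level_le[of n x] below_level[of _ n x] in \<open>auto simp: d b\<close>)
    then show ?thesis using level_le[of n x] by simp
  qed
  then show ?thesis by (simp add: place_def copies_def c)
qed

lemma level_mono: "n \<le> n' \<Longrightarrow> level n x \<le> level n' x"
proof (rule lift_Suc_mono_le[of "\<lambda>n. level n x"])
  show "level n x \<le> level (Suc n) x" for n
    using level_step[of n x] by (auto simp: place_def split: if_splits)
qed

text \<open>Eventually the depth reaches \<open>L\<close> and the bounds have absorbed the first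
  \<open>L\<close> values of \<open>x\<close>.\<close>

lemma level_unbounded: "\<exists>n. L \<le> level n x"
proof -
  obtain n0 where n0: "L \<le> depth n0" using depth_unbounded by blast
  have "\<forall>j. \<exists>n. x j \<le> bound n j" using bound_unbounded by blast
  then obtain N where N: "\<And>j. x j \<le> bound (N j) j" by metis
  define n where "n = Max (insert n0 (N ` {..<L}))"
  have "x j \<le> bound n j" if "j < L" for j
    using N[of j] bound_mono[of "N j" n j] that by (simp add: n_def)
  moreover have "L \<le> depth n" using n0 depth_mono[of n0 n] by (simp add: n_def)
  ultimately have "L \<le> level n x" using at_level[of n x] by (metis leD not_le_imp_less)
  then show ?thesis by blast
qed

text \<open>
  Whenever the level changes, \<open>x\<close> moves into a freshly created set, which is a subset of a small
  cylinder. This is what makes the sets attached to \<open>x\<close> shrink to a point.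
\<close>

lemma level_changes: "\<exists>n\<ge>k. level (Suc n) x \<noteq> level n x"
proof (rule ccontr)
  assume "\<not> ?thesis"
  then have const: "level (Suc n) x = level n x" if "k \<le> n" for n using that by blast
  obtain n where n: "Suc (level k x) \<le> level n x" using level_unbounded by blast
  then have "\<not> n \<le> k" using level_mono[of n k x] by auto
  then have "k \<le> n" by simp
  then have "level n x = level k x" by (induction rule: dec_induct) (simp_all add: const)
  then show False using n by simp
qed

text \<open>The bound is \<open>0\<close> beyond the depth, so clipping erases the later
  coordinates, and the search for the level stops at the depth.\<close>

lemma leaf_level_cong:
  assumes "agree (depth n) x y"
  shows "leaf n x = leaf n y" "level n x = level n y"
proof -
  show "leaf n x = leaf n y"
  proof
    fix j show "leaf n x j = leaf n y j"
      using assms bound_beyond[of n j]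
      by (cases "j < depth n") (auto simp: leaf_def agree_def clip_def)
  qed
  show "level n x = level n y"
  proof (rule level_eqI)
    show "level n y \<le> depth n" by (rule level_le)
    show "x k \<le> bound n k" if "k < level n y" for k
      using below_level[OF that] assms that level_le[of n y] by (auto simp: agree_def)
    show "level n y = depth n \<or> bound n (level n y) < x (level n y)"
      using at_level[of n y] assms level_le[of n y] by (auto simp: agree_def le_less)
  qed
qed

section \<open>Limit points of the nested sets\<close>

lemma nested_cylinder_limit:
  fixes W :: "nat \<Rightarrow> (nat \<Rightarrow> 'c) set"
  assumes dec: "\<And>n. W (Suc n) \<subseteq> W n" and ne: "\<And>n. W n \<noteq> {}"
    and cyl: "\<And>n. \<exists>N z. W N \<subseteq> cylinder n z"
  obtains z where "\<And>n. \<exists>N. W N \<subseteq> cylinder n z"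
proof -
  have mono: "n \<le> n' \<Longrightarrow> W n' \<subseteq> W n" for n n' by (rule lift_Suc_antimono_le[of W]) (rule dec)
  obtain N z where Nz: "\<And>n. W (N n) \<subseteq> cylinder n (z n)" using cyl by metis
  \<comment> \<open>Length \<open>Suc j\<close> is the first that prescribes coordinate
    \<open>j\<close>. Nested nonempty sets have common points two at a time, so all prescriptions
    agree.\<close>
  define y where "y = (\<lambda>j. z (Suc j) j)"
  have "z n j = y j" if "j < n" for n j
  proof -
    obtain w where "w \<in> W (max (N n) (N (Suc j)))" using ne by blast
    then have "w \<in> W (N n)" "w \<in> W (N (Suc j))" using mono[of "N n" "max (N n) (N (Suc j))"]
      mono[of "N (Suc j)" "max (N n) (N (Suc j))"] by auto
    then have "w \<in> cylinder n (z n)" "w \<in> cylinder (Suc j) (z (Suc j))" using Nz by blast+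
    then show ?thesis using that by (auto simp: cylinder_def y_def)
  qed
  then have "cylinder n (z n) = cylinder n y" for n by (auto simp: cylinder_def)
  then show ?thesis using that[of y] Nz by metis
qed

lemma open_contains_cylinder:
  assumes "open S" "z \<in> S"
  obtains n where "cylinder n (z :: nat \<Rightarrow> nat) \<subseteq> S"
proof -
  obtain X where X: "z \<in> Pi\<^sub>E UNIV X" "\<And>i. open (X i)" "finite {i. X i \<noteq> UNIV}" "Pi\<^sub>E UNIV X \<subseteq> S"
    using product_topology_open_contains_basis[of "\<lambda>_. euclidean" UNIV S z] assms
    unfolding euclidean_product_topology by auto
  obtain n where n: "\<And>i. X i \<noteq> UNIV \<Longrightarrow> i < n"
    using X(3) finite_nat_bounded[of "{i. X i \<noteq> UNIV}"] by (auto simp: subset_iff)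
  have "cylinder n z \<subseteq> Pi\<^sub>E UNIV X"
  proof
    fix w assume w: "w \<in> cylinder n z"
    have "w i \<in> X i" for i
    proof (cases "X i = UNIV")
      case False
      then have "w i = z i" using n w by (simp add: cylinder_def)
      then show ?thesis using X(1) by (simp add: PiE_iff)
    qed simp
    then show "w \<in> Pi\<^sub>E UNIV X" by (simp add: PiE_iff)
  qed
  then have "cylinder n z \<subseteq> S" using X(4) by (rule order_trans)
  then show ?thesis by (rule that)
qed

context parametrized_function
begin

text \<open>A gap under the continuous \<open>q\<close> is a closed condition. This matters because
  limit points are only known to lie in closures.\<close>

lemma separated_closure:
  assumes "separated r S S'" "z \<in> closure S" "z' \<in> closure S'"
  shows "r \<le> dist (q z) (q z')"
proof -
  have 1: "continuous_on UNIV (\<lambda>w. q (fst w))" "continuous_on UNIV (\<lambda>w. q (snd w))"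
    by (auto intro!: continuous_on_compose2[OF cont_q] continuous_on_fst continuous_on_snd continuous_on_id)
  have "closed {w. r \<le> dist (q (fst w)) (q (snd w))}"
    by (intro closed_Collect_le continuous_intros 1)
  moreover have "S \<times> S' \<subseteq> {w. r \<le> dist (q (fst w)) (q (snd w))}"
    using assms(1) by (auto simp: separated_def)
  ultimately have "closure (S \<times> S') \<subseteq> {w. r \<le> dist (q (fst w)) (q (snd w))}"
    by (rule closure_minimal[rotated])
  then show ?thesis using assms(2,3) by (auto simp: closure_Times)
qed

lemma construction:
  assumes "\<not> small UNIV"
  obtains U x where "\<And>n. state (depth n) (bound n) (U n) (x n)"
    "\<And>n. refines (site n) (depth n) (bound n) n ((1/2) ^ n) (U n) (x n) (U (Suc n)) (x (Suc n))"
proof -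
  define P where "P = (\<lambda>n (U, x). state (depth n) (bound n) U x)"
  define Q where "Q = (\<lambda>n (U, x) (U', x'). refines (site n) (depth n) (bound n) n ((1/2) ^ n) U x U' x')"
  have "\<exists>f. \<forall>n. P n (f n) \<and> Q n (f n) (f (Suc n))"
  proof (rule dependent_nat_choice)
    \<comment> \<open>The first stage has the single leaf \<open>0\<close>, with the whole space as
      its set and any point of the support as its centre.\<close>
    obtain a where a: "a \<in> supp p UNIV" using supp_nonempty[OF assms, of p] by blast
    have "state 0 (\<lambda>_. 0) (\<lambda>_ _. UNIV) (\<lambda>_. a)"
      unfolding state_def using a
      by (intro conjI ballI allI impI exI[of _ 1]) (auto simp: leaves_def agree_def)
    then have "P 0 (\<lambda>_ _. UNIV, \<lambda>_. a)" by (simp add: P_def depth_0 bound_0)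
    then show "\<exists>s. P 0 s" by blast
  next
    fix s n assume "P n s"
    then obtain U x where s: "s = (U, x)" "state (depth n) (bound n) U x"
      by (cases s) (simp add: P_def)
    obtain U' x' where "state (depth (Suc n)) (bound (Suc n)) U' x'"
        "refines (site n) (depth n) (bound n) n ((1/2) ^ n) U x U' x'"
      unfolding depth_Suc bound_Suc
      by (rule refinement_exists[OF s(2) site_le, of "(1/2) ^ n" n]) auto
    then have "P (Suc n) (U', x') \<and> Q n s (U', x')" by (simp add: P_def Q_def s)
    then show "\<exists>s'. P (Suc n) s' \<and> Q n s s'" by blast
  qed
  then obtain f where f: "\<And>n. P n (f n)" "\<And>n. Q n (f n) (f (Suc n))" by blast
  show ?thesis
    by (rule that[of "\<lambda>n. fst (f n)" "\<lambda>n. snd (f n)"])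
      (use f in \<open>simp_all add: P_def Q_def case_prod_unfold\<close>)
qed

text \<open>\<open>z x\<close> is the limit of the sets attached to \<open>x\<close>. Points that
  agree far enough share such a set, which gives continuity of \<open>z\<close>. The gaps of a stage
  recover coordinates from \<open>q\<close>, and the centres, which depend only on clipped values,
  approximate \<open>p (z x)\<close> uniformly.\<close>

lemma embedding_exists:
  assumes "\<not> small UNIV"
  obtains z :: "(nat \<Rightarrow> nat) \<Rightarrow> nat \<Rightarrow> nat" where
    "\<And>x n. \<exists>k. \<forall>y. agree k x y \<longrightarrow> z y \<in> cylinder n (z x)"
    "\<And>x n. \<exists>r>0. \<forall>y. dist (q (z x)) (q (z y)) < r \<longrightarrow> agree n x y"
    "\<And>e. e > 0 \<Longrightarrow> \<exists>m b. \<forall>x y. (\<forall>j<m. clip (b j) (x j) = clip (b j) (y j)) \<longrightarrow> dist (p (z x)) (p (z y)) < e"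
proof -
  obtain U c where st: "\<And>n. state (depth n) (bound n) (U n) (c n)"
    and rf: "\<And>n. refines (site n) (depth n) (bound n) n ((1/2) ^ n) (U n) (c n) (U (Suc n)) (c (Suc n))"
    using construction[OF assms] by blast
  define W where "W = (\<lambda>x n. U n (leaf n x) (level n x))"
  define a where "a = (\<lambda>x n. c n (leaf n x))"
  have step: "dist (a x (Suc n)) (a x n) \<le> (1/2) ^ n" "W x (Suc n) \<subseteq> W x n"
    "level (Suc n) x \<noteq> level n x \<Longrightarrow> (\<exists>z. W x (Suc n) \<subseteq> cylinder n z) \<and> p ` W x (Suc n) \<subseteq> cball (a x n) ((1/2) ^ n)"
    for x n
  proof -
    let ?N = "copies (site n) (depth n) (bound n)"
    have l: "leaf (Suc n) x \<in> leaves (bound' (site n) (depth n) (bound n))"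
      "level (Suc n) x \<le> depth' (site n) (depth n)"
      using leaf_in_leaves[of "Suc n" x] level_le[of "Suc n" x] by (simp_all add: bound_Suc depth_Suc)
    note r = rf[of n, unfolded refines_def, rule_format, OF l(1), unfolded leaf_step]
    note r2 = conjunct2[OF r, rule_format, OF l(2), unfolded level_step]
    show "dist (a x (Suc n)) (a x n) \<le> (1/2) ^ n" using r by (simp add: a_def)
    show "W x (Suc n) \<subseteq> W x n" using conjunct1[OF r2] by (simp add: W_def)
    assume "level (Suc n) x \<noteq> level n x"
    then have "leaf (Suc n) x \<in> ?N \<and> site n \<le> level (Suc n) x"
      using level_step[of n x] by (auto simp: place_def split: if_splits)
    then show "(\<exists>z. W x (Suc n) \<subseteq> cylinder n z) \<and> p ` W x (Suc n) \<subseteq> cball (a x n) ((1/2) ^ n)"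
      using conjunct2[OF r2] unfolding W_def a_def by blast
  qed
  have mono: "n \<le> n' \<Longrightarrow> W x n' \<subseteq> W x n" for x n n' by (rule lift_Suc_antimono_le[of "W x"]) (rule step(2))
  have ne: "W x n \<noteq> {}" for x n
  proof -
    have "c n (leaf n x) \<in> reach (leaf n x) (U n (leaf n x)) (Suc (depth n))"
      using st[of n] leaf_in_leaves[of n x] unfolding state_def by (simp del: reach.simps)
    then have "c n (leaf n x) \<in> reach (leaf n x) (U n (leaf n x)) (Suc (level n x))"
      using reach_antimono[of "Suc (level n x)" "Suc (depth n)"] level_le[of n x] by blast
    then have "c n (leaf n x) \<in> supp p (W x n \<inter> p -` reach (leaf n x) (U n (leaf n x)) (level n x))"
      by (simp add: leaf_at_level W_def)
    then show ?thesis by (metis Int_empty_left empty_iff supp_empty)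
  qed
  have cyl: "\<exists>N z. W x N \<subseteq> cylinder n z" for x n
  proof -
    obtain k where k: "k \<ge> n" "level (Suc k) x \<noteq> level k x" using level_changes by blast
    then obtain z where "W x (Suc k) \<subseteq> cylinder k z" using step(3) by blast
    also have "cylinder k z \<subseteq> cylinder n z" using k(1) by (auto simp: cylinder_def)
    finally show ?thesis by blast
  qed
  have "\<exists>z. \<forall>n. \<exists>N. W x N \<subseteq> cylinder n z" for x
    by (rule nested_cylinder_limit[of "W x"]) (use step(2) ne cyl in blast)+
  then obtain z where z: "\<And>x n. \<exists>N. W x N \<subseteq> cylinder n (z x)" by metis
  have clos: "z x \<in> closure (W x n)" for x n
    unfolding closure_iff_nhds_not_empty
  proof (intro allI impI)
    fix T S assume "S \<subseteq> T" "open S" "z x \<in> S"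
    then obtain k where "cylinder k (z x) \<subseteq> T" using open_contains_cylinder by (metis order_trans)
    moreover obtain N where "W x N \<subseteq> cylinder k (z x)" using z by blast
    moreover have "W x (max N n) \<subseteq> W x N" "W x (max N n) \<subseteq> W x n" by (auto intro!: mono)
    ultimately show "W x n \<inter> T \<noteq> {}" using ne[of x "max N n"] by blast
  qed
  \<comment> \<open>The geometric sum is kept in closed form; the subtracted term later absorbs the
    last error.\<close>
  have near: "dist (a x n) (a x (n + k)) \<le> 2 * (1/2) ^ n - 2 * (1/2) ^ (n + k)" for x n k
  proof (induction k)
    case (Suc k)
    have "dist (a x n) (a x (n + Suc k)) \<le> dist (a x n) (a x (n + k)) + dist (a x (Suc (n + k))) (a x (n + k))"
      using dist_triangle2[of "a x n" "a x (n + Suc k)" "a x (n + k)"] by simp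
    also have "\<dots> \<le> 2 * (1/2) ^ n - 2 * (1/2) ^ (n + k) + (1/2) ^ (n + k)"
      using Suc step(1)[of x "n + k"] by linarith
    finally show ?case by simp
  qed simp
  \<comment> \<open>At a level change the set of \<open>x\<close> is fresh, so its
    \<open>p\<close>-image, and with it \<open>p (z x)\<close>, lies within \<open>(1/2) ^ k\<close>
    of the centre.\<close>
  have lim: "dist (a x n) (p (z x)) \<le> 2 * (1/2) ^ n" for x n
  proof -
    obtain k where k: "k \<ge> n" "level (Suc k) x \<noteq> level k x" using level_changes by blast
    have "W x (Suc k) \<subseteq> p -` cball (a x k) ((1/2) ^ k)" using step(3)[OF k(2)] by blast
    moreover have "closed (p -` cball (a x k) ((1/2) ^ k))"
      using cont_p by (simp add: closed_vimage)
    ultimately have "closure (W x (Suc k)) \<subseteq> p -` cball (a x k) ((1/2) ^ k)" by (rule closure_minimal)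
    then have "dist (a x k) (p (z x)) \<le> (1/2) ^ k" using clos[of x "Suc k"] by auto
    moreover have "dist (a x n) (a x k) \<le> 2 * (1/2) ^ n - 2 * (1/2) ^ k"
      using near[of x n "k - n"] k(1) by simp
    moreover have "(0::real) \<le> (1/2) ^ k" by simp
    ultimately show ?thesis using dist_triangle[of "a x n" "p (z x)" "a x k"] by linarith
  qed
  show ?thesis
  proof (rule that[of z])
    show "\<exists>k. \<forall>y. agree k x y \<longrightarrow> z y \<in> cylinder n (z x)" for x n
    proof -
      obtain N where N: "W x N \<subseteq> cylinder n (z x)" using z by blast
      have "z y \<in> cylinder n (z x)" if "agree (depth N) x y" for y
      proof -
        obtain N' where N': "W y N' \<subseteq> cylinder n (z y)" using z by blast
        have "W y N = W x N" using leaf_level_cong[OF that] by (simp add: W_def)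
        moreover obtain w where "w \<in> W y (max N N')" using ne by blast
        moreover have "W y (max N N') \<subseteq> W y N" "W y (max N N') \<subseteq> W y N'" by (auto intro!: mono)
        ultimately have "w \<in> cylinder n (z x)" "w \<in> cylinder n (z y)" using N N' by blast+
        then show ?thesis by (simp add: cylinder_def)
      qed
      then show ?thesis by blast
    qed
    show "\<exists>r>0. \<forall>y. dist (q (z x)) (q (z y)) < r \<longrightarrow> agree L x y" for x L
    proof -
      \<comment> \<open>The stage depends on \<open>x\<close> alone, so one gap \<open>r\<close>
        works for all \<open>y\<close>. Below the level clipping changes nothing, so agreement of
        leaves is agreement of points.\<close>
      obtain n where n: "L \<le> level n x" using level_unbounded by blast
      obtain r where r: "r > 0" "\<forall>d\<in>leaves (bound n). \<forall>e\<in>leaves (bound n). \<forall>i\<le>depth n. \<forall>j\<le>depth n.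
          \<not> (i = j \<and> agree i d e) \<longrightarrow> separated r (U n d i) (U n e j)"
        using st[of n, unfolded state_def, THEN conjunct2, THEN conjunct2] by (elim exE conjE) (rule that)
      have "agree L x y" if "dist (q (z x)) (q (z y)) < r" for y
      proof -
        have "\<not> separated r (W x n) (W y n)"
          using separated_closure[OF _ clos clos, of r x n y n] that by auto
        then have eq: "level n x = level n y" "agree (level n x) (leaf n x) (leaf n y)"
          using r(2)[rule_format, OF leaf_in_leaves leaf_in_leaves level_le level_le, of x y] unfolding W_def by blast+
        have "x t = y t" if "t < L" for t
        proof -
          have t: "t < level n x" using that n by simp
          then have "x t \<le> bound n t" "y t \<le> bound n t" using below_level[of t n] eq(1) by auto
          moreover have "leaf n x t = leaf n y t" using eq(2) t by (simp add: agree_def)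
          ultimately show ?thesis by (simp add: leaf_def clip_def)
        qed
        then show ?thesis by (simp add: agree_def)
      qed
      then show ?thesis using r(1) by blast
    qed
    show "\<exists>m b. \<forall>x y. (\<forall>j<m. clip (b j) (x j) = clip (b j) (y j)) \<longrightarrow> dist (p (z x)) (p (z y)) < e"
      if e: "e > 0" for e
    proof -
      \<comment> \<open>Two errors of at most \<open>2 * (1/2) ^ n\<close> from a common centre add
        up to less than \<open>e\<close>.\<close>
      obtain n where n: "(1/2) ^ n < e / 4" using e real_arch_pow_inv[of "e/4" "1/2"] by auto
      have "dist (p (z x)) (p (z y)) < e"
        if "\<forall>j<depth n. clip (bound n j) (x j) = clip (bound n j) (y j)" for x y
      proof -
        have "leaf n x = leaf n y"
        proof
          fix j show "leaf n x j = leaf n y j"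
            using that bound_beyond[of n j] by (cases "j < depth n") (auto simp: leaf_def clip_def)
        qed
        then have "a x n = a y n" by (simp add: a_def)
        then show ?thesis
          using lim[of x n] lim[of y n] dist_triangle3[of "p (z x)" "p (z y)" "a x n"] n by simp
      qed
      then show ?thesis by blast
    qed
  qed
qed

end

subsection \<open>The topologies\<close>

lemma hilbert_cube_eq: "hilbert_cube = subtopology euclidean (Pi\<^sub>E UNIV (\<lambda>_. {0..1}))"
  unfolding hilbert_cube_def subtopology_product_topology[symmetric] euclidean_product_topology ..

lemma compact_cube: "compact (Pi\<^sub>E UNIV (\<lambda>_ :: nat. {0..1 :: real}))"
proof -
  have "compactin (product_topology (\<lambda>_ :: nat. euclideanreal) UNIV) (Pi\<^sub>E UNIV (\<lambda>_. {0..1}))"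
    by (subst compactin_PiE) auto
  then show ?thesis by (simp add: euclidean_product_topology)
qed

lemma baire_topology_eq: "baire_topology = euclidean"
proof -
  have "discrete_topology (UNIV :: nat set) = euclidean"
    by (simp add: topology_eq open_discrete flip: open_openin)
  then show ?thesis unfolding baire_topology_def by (simp add: euclidean_product_topology)
qed

lemma seq_code_less_iff: "seq_code k < (1/2) ^ b \<longleftrightarrow> k = 0 \<or> b < k"
  by (simp add: seq_code_def)

lemma less_seq_code_iff: "(1/2) ^ b < seq_code k \<longleftrightarrow> k \<noteq> 0 \<and> k < b"
  by (simp add: seq_code_def)

text \<open>The fibre over \<open>0\<close> consists of \<open>0\<close> and a tail, a neighbourhood
  of the limit; every other fibre is an isolated point or empty.\<close>

lemma openin_clip_fibre: "openin (pullback_topology UNIV seq_code euclideanreal) {k. clip b k = v}"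
proof -
  have "\<exists>T. open T \<and> {k. clip b k = v} = seq_code -` T"
  proof (cases v)
    case 0
    then have "{k. clip b k = v} = seq_code -` {..<(1/2) ^ b}"
      by (auto simp: seq_code_less_iff clip_def)
    then show ?thesis by (intro exI conjI) (rule open_lessThan)
  next
    case (Suc u)
    show ?thesis
    proof (cases "v \<le> b")
      case True
      \<comment> \<open>The powers adjacent to \<open>(1/2) ^ v\<close> bound an interval whose only
        code is that of \<open>v\<close>.\<close>
      have "clip b k = v \<longleftrightarrow> (1/2) ^ Suc v < seq_code k \<and> seq_code k < (1/2) ^ u" for k
        unfolding less_seq_code_iff seq_code_less_iff using True Suc by (auto simp: clip_def)
      then have "{k. clip b k = v} = seq_code -` {(1/2) ^ Suc v<..<(1/2) ^ u}"
        by (simp only: set_eq_iff mem_Collect_eq vimage_eq greaterThanLessThan_iff) blast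
      then show ?thesis by (intro exI conjI) (rule open_greaterThanLessThan)
    next
      case False
      then have "{k. clip b k = v} = seq_code -` {}" using clip_le[of b] by auto
      then show ?thesis by (intro exI conjI) (rule open_empty)
    qed
  qed
  then show ?thesis by (auto simp: openin_pullback_topology)
qed

lemma topspace_cantor_topology [simp]: "topspace cantor_topology = UNIV"
  by (simp add: cantor_topology_def topspace_pullback_topology)

text \<open>In a factor, an open set around \<open>0\<close> omits only finitely many points. The
  product is then compact by Tychonoff.\<close>

lemma compact_space_cantor_topology: "compact_space cantor_topology"
proof -
  have "compact_space (pullback_topology UNIV seq_code euclideanreal)"
    unfolding compact_space_alt
  proof (intro allI impI)
    fix \<U> assume U: "(\<forall>U\<in>\<U>. openin (pullback_topology UNIV seq_code euclideanreal) U) \<and>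
        topspace (pullback_topology UNIV seq_code euclideanreal) \<subseteq> \<Union> \<U>"
    then have cov: "\<exists>V\<in>\<U>. k \<in> V" for k by (auto simp: topspace_pullback_topology)
    then obtain V where V: "\<And>k. V k \<in> \<U>" "\<And>k. k \<in> V k" by metis
    obtain T where T: "open T" "V 0 = seq_code -` T"
      using U V(1)[of 0] by (auto simp: openin_pullback_topology)
    have "0 \<in> T" using V(2)[of 0] T(2) by (simp add: seq_code_def)
    then obtain e where e: "e > 0" "ball 0 e \<subseteq> T" using T(1) by (meson open_contains_ball)
    obtain N where N: "(1/2) ^ N < e" using real_arch_pow_inv[of e "1/2"] e(1) by auto
    have tail: "k \<in> V 0" if "N < k" for k
    proof -
      have "seq_code k < (1/2) ^ N" using that by (simp add: seq_code_less_iff)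
      moreover have "0 \<le> seq_code k" by (simp add: seq_code_def)
      ultimately have "seq_code k \<in> ball 0 e" using N by simp
      then show ?thesis using e(2) T(2) by auto
    qed
    have "UNIV \<subseteq> \<Union> (V ` {..N})"
    proof
      fix k show "k \<in> \<Union> (V ` {..N})"
        using V(2)[of k] tail[of k] by (cases "k \<le> N") auto
    qed
    then show "\<exists>\<F>. finite \<F> \<and> \<F> \<subseteq> \<U> \<and> topspace (pullback_topology UNIV seq_code euclideanreal) \<subseteq> \<Union> \<F>"
      using V(1) by (intro exI[of _ "V ` {..N}"]) auto
  qed
  then show ?thesis unfolding cantor_topology_def by (simp add: compact_space_product_topology)
qed

lemma openin_cantor_clip: "openin cantor_topology {y. \<forall>j<m. clip (b j) (x j) = clip (b j) (y j)}"
proof (induction m)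
  case 0
  then show ?case using openin_topspace[of cantor_topology] by simp
next
  case (Suc m)
  have "continuous_map cantor_topology (pullback_topology UNIV seq_code euclideanreal) (\<lambda>y. y m)"
    unfolding cantor_topology_def by (rule continuous_map_product_projection) simp
  then have "openin cantor_topology {y \<in> topspace cantor_topology. y m \<in> {k. clip (b m) k = clip (b m) (x m)}}"
    by (rule openin_continuous_map_preimage) (rule openin_clip_fibre)
  then have "openin cantor_topology ({y. \<forall>j<m. clip (b j) (x j) = clip (b j) (y j)} \<inter>
      {y. clip (b m) (y m) = clip (b m) (x m)})"
    using Suc by (intro openin_Int) simp_all
  moreover have "{y. \<forall>j<m. clip (b j) (x j) = clip (b j) (y j)} \<inter>
      {y. clip (b m) (y m) = clip (b m) (x m)} = {y. \<forall>j<Suc m. clip (b j) (x j) = clip (b j) (y j)}"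
    by (auto simp: less_Suc_eq)
  ultimately show ?case by simp
qed

lemma continuous_map_cantor:
  fixes f :: "(nat \<Rightarrow> nat) \<Rightarrow> 'a::metric_space"
  assumes "\<And>e. e > 0 \<Longrightarrow> \<exists>m b. \<forall>x y. (\<forall>j<m. clip (b j) (x j) = clip (b j) (y j)) \<longrightarrow> dist (f x) (f y) < e"
  shows "continuous_map cantor_topology euclidean f"
  unfolding continuous_map_def
proof (intro conjI allI impI)
  fix S :: "'a set" assume "openin euclidean S"
  then have S: "open S" by simp
  show "openin cantor_topology {x \<in> topspace cantor_topology. f x \<in> S}"
  proof (subst openin_subopen, intro ballI)
    fix x assume "x \<in> {x \<in> topspace cantor_topology. f x \<in> S}"
    then obtain e where e: "e > 0" "ball (f x) e \<subseteq> S" using S by (auto simp: open_contains_ball)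
    obtain m b where mb: "\<forall>x y. (\<forall>j<m. clip (b j) (x j) = clip (b j) (y j)) \<longrightarrow> dist (f x) (f y) < e"
      using assms[OF e(1)] by blast
    let ?T = "{y. \<forall>j<m. clip (b j) (x j) = clip (b j) (y j)}"
    have "openin cantor_topology ?T" by (rule openin_cantor_clip)
    moreover have "?T \<subseteq> {x \<in> topspace cantor_topology. f x \<in> S}" using mb e(2) by (auto simp: subset_iff)
    ultimately show "\<exists>T. openin cantor_topology T \<and> x \<in> T \<and> T \<subseteq> {x \<in> topspace cantor_topology. f x \<in> S}"
      by blast
  qed
qed simp

lemma mem_cylinder_iff: "y \<in> cylinder n x \<longleftrightarrow> agree n x y"
  by (auto simp: agree_def cylinder_def)

lemma agree_imp_eq: "(\<And>n. agree n x y) \<Longrightarrow> x = y"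
  unfolding agree_def by (metis ext lessI)

text \<open>Since cylinders form a base, \<open>sep\<close> is continuity of the inverse on the
  image; it also yields injectivity.\<close>

lemma embedding_map_baire:
  fixes f :: "(nat \<Rightarrow> nat) \<Rightarrow> 'b::metric_space"
  assumes cont: "continuous_on UNIV f"
    and sep: "\<And>x n. \<exists>r>0. \<forall>y. dist (f x) (f y) < r \<longrightarrow> agree n x y"
  shows "embedding_map euclidean euclidean f"
  unfolding embedding_map_def
proof (rule bijective_open_imp_homeomorphic_map)
  show "inj_on f (topspace euclidean)"
  proof (rule inj_onI)
    fix x y assume eq: "f x = f y"
    show "x = y"
    proof (rule agree_imp_eq)
      fix n show "agree n x y" using sep[of x n] eq by auto
    qed
  qed
  show "continuous_map euclidean (subtopology euclidean (f ` topspace euclidean)) f"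
    using cont by (simp add: continuous_map_in_subtopology)
  show "open_map euclidean (subtopology euclidean (f ` topspace euclidean)) f"
    unfolding open_map_def
  proof (intro allI impI)
    fix U :: "(nat \<Rightarrow> nat) set" assume "openin euclidean U"
    then have U: "open U" by simp
    have "\<exists>r>0. \<forall>y. dist (f x) (f y) < r \<longrightarrow> y \<in> U" if "x \<in> U" for x
    proof -
      obtain n where n: "cylinder n x \<subseteq> U" using open_contains_cylinder[OF U \<open>x \<in> U\<close>] .
      obtain r where "r > 0" "\<forall>y. dist (f x) (f y) < r \<longrightarrow> agree n x y" using sep by blast
      then show ?thesis using n by (intro exI[of _ r]) (auto simp: agree_def cylinder_def)
    qed
    then obtain r where r: "\<And>x. x \<in> U \<Longrightarrow> r x > 0" "\<And>x y. x \<in> U \<Longrightarrow> dist (f x) (f y) < r x \<Longrightarrow> y \<in> U"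
      by metis
    have "f ` U = (\<Union>x\<in>U. ball (f x) (r x)) \<inter> range f"
      using r by force
    then show "openin (subtopology euclidean (f ` topspace euclidean)) (f ` U)"
      unfolding openin_subtopology by (intro exI[of _ "\<Union>x\<in>U. ball (f x) (r x)"]) auto
  qed
qed simp

section \<open>From the parametrized construction to the dichotomy in the Hilbert cube\<close>

theorem theorem1:
  fixes Adot Addot :: "(nat \<Rightarrow> real) set"
    and A :: "(nat \<Rightarrow> real) \<Rightarrow> (nat \<Rightarrow> real)"
  assumes "analytic_in hilbert_cube Adot"
    and "analytic_in hilbert_cube Addot"
    and "A \<in> Adot \<rightarrow> Addot"
    and "analytic_in (prod_topology (subtopology hilbert_cube Adot) (subtopology hilbert_cube Addot))
           (fun_graph Adot A)"
  shows "countably_continuous_cover hilbert_cube hilbert_cube (fun_graph Adot A) \<or>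
    (\<exists>(phidot :: (nat \<Rightarrow> nat) \<Rightarrow> (nat \<Rightarrow> real)) (phiddot :: (nat \<Rightarrow> nat) \<Rightarrow> (nat \<Rightarrow> real)).
       A \<circ> phidot = phiddot \<circ> P_map \<and>
       embedding_map cantor_topology (subtopology hilbert_cube Adot) phidot \<and>
       embedding_map baire_topology (subtopology hilbert_cube Addot) phiddot)"
proof (cases "fun_graph Adot A = {}")
  \<comment> \<open>An empty graph has no parametrization; empty functions cover it.\<close>
  case True
  then have "countably_continuous_cover hilbert_cube hilbert_cube (fun_graph Adot A)"
    unfolding countably_continuous_cover_def
    by (intro exI[of _ "\<lambda>_. {}"] exI[of _ "\<lambda>_. A"]) (simp add: continuous_map_on_empty2)
  then show ?thesis by blast
next
  case False
  define H where "H = Pi\<^sub>E UNIV (\<lambda>_ :: nat. {0..1 :: real})"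
  have hc: "hilbert_cube = subtopology euclidean H" by (simp add: hilbert_cube_eq H_def)
  obtain f where f: "continuous_map baire_topology
        (prod_topology (subtopology hilbert_cube Adot) (subtopology hilbert_cube Addot)) f"
      "f ` topspace baire_topology = fun_graph Adot A"
    using assms(4) False unfolding analytic_in_def by blast
  define p q where "p = fst \<circ> f" and "q = snd \<circ> f"
  have "continuous_map baire_topology (subtopology hilbert_cube Adot) p"
    "continuous_map baire_topology (subtopology hilbert_cube Addot) q"
    using f(1) unfolding p_def q_def by (simp_all add: continuous_map_pairwise)
  then have p: "continuous_on UNIV p" "\<And>z. p z \<in> H \<inter> Adot"
    and q: "continuous_on UNIV q" "\<And>z. q z \<in> H \<inter> Addot"
    unfolding hc baire_topology_eq subtopology_subtopology
    by (auto simp: continuous_map_in_subtopology)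
  have range: "range f = fun_graph Adot A" using f(2) by (simp add: baire_topology_eq)
  interpret parametrized_function p q A H
  proof
    fix z have "f z \<in> fun_graph Adot A" using range by blast
    then show "q z = A (p z)" by (auto simp: fun_graph_def p_def q_def)
    show "q z \<in> H" using q(2) by blast
  qed (use p(1) q(1) compact_cube in \<open>auto simp: H_def\<close>)
  \<comment> \<open>Smallness of the whole parameter space yields the cover, and its failure the
    embeddings.\<close>
  show ?thesis
  proof (cases "small UNIV")
    case True
    then obtain T :: "nat \<Rightarrow> _" where T: "UNIV \<subseteq> (\<Union>n. T n)" "\<And>n. continuous_on (p ` T n) A"
      unfolding small_def by blast
    have "continuous_map (subtopology hilbert_cube (p ` T n)) hilbert_cube A" for n
    proof -
      have "H \<inter> p ` T n = p ` T n" using p(2) by blast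
      moreover have "A ` p ` T n \<subseteq> H" using q(2) q_eq by auto
      ultimately show ?thesis unfolding hc subtopology_subtopology
        using T(2)[of n] by (auto simp: continuous_map_in_subtopology)
    qed
    moreover have "fun_graph Adot A \<subseteq> (\<Union>n. fun_graph (p ` T n) A)"
    proof
      fix g assume "g \<in> fun_graph Adot A"
      then obtain z where z: "g = f z" using range by blast
      obtain n where "z \<in> T n" using T(1) by blast
      then have "(p z, A (p z)) \<in> fun_graph (p ` T n) A" unfolding fun_graph_def by blast
      moreover have "g = (p z, A (p z))" unfolding q_eq[symmetric] by (simp add: z p_def q_def)
      ultimately show "g \<in> (\<Union>n. fun_graph (p ` T n) A)" by blast
    qed
    moreover have "p ` T n \<subseteq> topspace hilbert_cube" for n using p(2) by (auto simp: hc)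
    ultimately have "countably_continuous_cover hilbert_cube hilbert_cube (fun_graph Adot A)"
      unfolding countably_continuous_cover_def
      by (intro exI[of _ "\<lambda>n. p ` T n"] exI[of _ "\<lambda>_. A"]) blast
    then show ?thesis ..
  next
    case False
    obtain z where z: "\<And>x n. \<exists>k. \<forall>y. agree k x y \<longrightarrow> z y \<in> cylinder n (z x)"
      "\<And>x n. \<exists>r>0. \<forall>y. dist (q (z x)) (q (z y)) < r \<longrightarrow> agree n x y"
      "\<And>e. e > 0 \<Longrightarrow> \<exists>m b. \<forall>x y. (\<forall>j<m. clip (b j) (x j) = clip (b j) (y j)) \<longrightarrow> dist (p (z x)) (p (z y)) < e"
      using embedding_exists[OF False] by blast
    have "continuous_on UNIV z"
      unfolding continuous_on_open_vimage[OF open_UNIV]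
    proof (intro allI impI)
      fix B :: "(nat \<Rightarrow> nat) set" assume B: "open B"
      show "open (z -` B \<inter> UNIV)"
      proof (subst open_subopen, intro ballI)
        fix x assume "x \<in> z -` B \<inter> UNIV"
        then have "z x \<in> B" by simp
        then obtain n where n: "cylinder n (z x) \<subseteq> B" by (rule open_contains_cylinder[OF B])
        obtain k where k: "\<forall>y. agree k x y \<longrightarrow> z y \<in> cylinder n (z x)" using z(1) by blast
        have "y \<in> z -` B \<inter> UNIV" if "y \<in> cylinder k x" for y
        proof -
          have "agree k x y" using that by (simp add: mem_cylinder_iff)
          then have "z y \<in> cylinder n (z x)" using k by blast
          then show ?thesis using n by blast
        qed
        then have "cylinder k x \<subseteq> z -` B \<inter> UNIV" by blast
        then show "\<exists>T. open T \<and> x \<in> T \<and> T \<subseteq> z -` B \<inter> UNIV"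
          by (intro exI[of _ "cylinder k x"]) (simp add: open_cylinder)
      qed
    qed
    then have "continuous_on UNIV (\<lambda>x. q (z x))"
      by (rule continuous_on_compose2[OF q(1)]) simp
    then have emb: "embedding_map euclidean euclidean (\<lambda>x. q (z x))"
      by (rule embedding_map_baire) (rule z(2))
    \<comment> \<open>Because \<open>q\<close> factors through \<open>p\<close>, injectivity along
      \<open>z\<close> passes from \<open>q\<close> to \<open>p\<close>.\<close>
    then have "inj (\<lambda>x. q (z x))"
      unfolding embedding_map_def by (auto dest: homeomorphic_imp_injective_map)
    then have inj_p: "inj (\<lambda>x. p (z x))"
      by (auto simp: inj_on_def q_eq)
    have embq: "embedding_map baire_topology (subtopology hilbert_cube Addot) (\<lambda>x. q (z x))"
      unfolding baire_topology_eq hc subtopology_subtopology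
      using emb q(2) by (auto simp: embedding_map_in_subtopology)
    \<comment> \<open>A continuous injection of a compact space into a Hausdorff space is an
      embedding.\<close>
    have "embedding_map cantor_topology euclidean (\<lambda>x. p (z x))"
      using continuous_map_cantor[of "\<lambda>x. p (z x)"] z(3) inj_p
      by (intro continuous_imp_embedding_map compact_space_cantor_topology) auto
    then have embp: "embedding_map cantor_topology (subtopology hilbert_cube Adot) (\<lambda>x. p (z x))"
      unfolding hc subtopology_subtopology using p(2) by (auto simp: embedding_map_in_subtopology)
    have "A \<circ> (\<lambda>x. p (z x)) = (\<lambda>x. q (z x)) \<circ> P_map"
      by (simp add: fun_eq_iff P_map_def q_eq)
    then show ?thesis using embp embq by blast
  qed
qed

end
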